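(* Let $G=(V,E,w)$ be an $n$-node graph with $|E| = \widetilde{\mathcal{O}}(n)$. There exists a deterministic distributed algorithm in the $\mathsf{HYBRID}$ model such that every node learns the entire topology of $G$ (all nodes, edges and edge weights) within $\widetilde{\mathcal{O}}(\sqrt{n})$ rounds.
   Context: Distributed setting: there are $n$ nodes with unique IDs from $\{1,\dots,n\}$; the local communication graph is $G=(V,E,w)$, undirected, with integer edge weights in $\{1,\dots,W\}$ for some $W=\mathrm{poly}(n)$. Initially each node knows only the IDs of its neighbors (and its incident edge weights). Computation proceeds in synchronous rounds with unlimited local computation. In the $\mathsf{HYBRID}$ model, in every round two communication modes are available simultaneously: (local mode, $\mathsf{LOCAL}$) every node may send a message of arbitrary size to each of its neighbors in $G$; (global mode, node-capacitated clique $\mathsf{NCC}$) every node may send and receive $\mathcal{O}(\log n)$-bit messages to/from up to $\mathcal{O}(\log n)$ arbitrary nodes of the network (addressed by ID); if this capacity is exceeded, only an arbitrary (possibly adversarial) subset of the messages is delivered. The notation $\widetilde{\mathcal{O}}(\cdot)$ suppresses factors polylogarithmic in $n$.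
   Formalization: The graph G is additionally assumed to be connected; without this the claim fails, since an isolated node can receive only polylogarithmically many bits per round and would need about n rounds to learn the topology. *)

theory Defs
  imports Complex_Main
begin

text \<open>
  A weighted graph on node IDs 1..n is given by an edge relation E (a set of
  ordered pairs, symmetric and irreflexive, so each undirected edge appears
  twice) and a weight function w.
\<close>

definition weighted_graph :: "nat \<Rightarrow> (nat \<times> nat) set \<Rightarrow> (nat \<Rightarrow> nat \<Rightarrow> nat) \<Rightarrow> nat \<Rightarrow> bool" where
  "weighted_graph n E w W \<longleftrightarrow>
     E \<subseteq> {1..n} \<times> {1..n} \<and>
     (\<forall>u v. (u, v) \<in> E \<longrightarrow> (v, u) \<in> E) \<and>
     (\<forall>u. (u, u) \<notin> E) \<and>
     (\<forall>u v. (u, v) \<in> E \<longrightarrow> w u v = w v u \<and> 1 \<le> w u v \<and> w u v \<le> W)"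

definition graph_connected :: "nat \<Rightarrow> (nat \<times> nat) set \<Rightarrow> bool" where
  "graph_connected n E \<longleftrightarrow> (\<forall>u\<in>{1..n}. \<forall>v\<in>{1..n}. (u, v) \<in> E\<^sup>*)"

text \<open>The complete topology: all edges together with their weights.\<close>
definition topology :: "(nat \<times> nat) set \<Rightarrow> (nat \<Rightarrow> nat \<Rightarrow> nat) \<Rightarrow> (nat \<times> nat \<times> nat) set" where
  "topology E w = {(u, v, w u v) | u v. (u, v) \<in> E}"

text \<open>
  A deterministic HYBRID algorithm with node states of type 'st and local
  messages of type 'lm. All functions receive n (node IDs are from 1..n).
  \<^item> init n v N: initial state of node v, N = set of (neighbour ID, edge weight)
  \<^item> loc n s u: LOCAL message (arbitrary size) sent to neighbour u in state s
  \<^item> glob n s: global (NCC) messages, list of (target ID, message); a message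
    is a natural number of O(log n) bits (see hybrid_wf)
  \<^item> trans n s L G: next state given received local messages L (sender, msg)
    and received global messages G (sender, msg)
  \<^item> out n s: the topology the node currently claims to know.
\<close>
record ('st, 'lm) hybrid_alg =
  init  :: "nat \<Rightarrow> nat \<Rightarrow> (nat \<times> nat) set \<Rightarrow> 'st"
  loc   :: "nat \<Rightarrow> 'st \<Rightarrow> nat \<Rightarrow> 'lm"
  glob  :: "nat \<Rightarrow> 'st \<Rightarrow> (nat \<times> nat) list"
  trans :: "nat \<Rightarrow> 'st \<Rightarrow> (nat \<times> 'lm) set \<Rightarrow> (nat \<times> nat) set \<Rightarrow> 'st"
  out   :: "nat \<Rightarrow> 'st \<Rightarrow> (nat \<times> nat \<times> nat) set"

text \<open>Global messages have at most C * log2 n bits, i.e. are numbers below n^C.\<close>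
definition hybrid_wf :: "('st, 'lm) hybrid_alg \<Rightarrow> nat \<Rightarrow> bool" where
  "hybrid_wf A C \<longleftrightarrow> (\<forall>n s v m. (v, m) \<in> set (glob A n s) \<longrightarrow> m < n ^ C)"

text \<open>Global messages sent in a round when the node states are s.\<close>
definition sent_glob :: "('st, 'lm) hybrid_alg \<Rightarrow> nat \<Rightarrow> (nat \<Rightarrow> 'st) \<Rightarrow> (nat \<times> nat \<times> nat) set" where
  "sent_glob A n s = {(u, v, m) | u v m. u \<in> {1..n} \<and> (v, m) \<in> set (glob A n (s u))}"

text \<open>
  A set D of delivered global messages is admissible if it only contains sent
  messages and contains every sent message whose sender sends and whose
  receiver receives at most cap messages in this round (otherwise an arbitrary,
  adversarially chosen subset is delivered).
\<close>
definition admissible_delivery ::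
  "('st, 'lm) hybrid_alg \<Rightarrow> nat \<Rightarrow> real \<Rightarrow> (nat \<Rightarrow> 'st) \<Rightarrow> (nat \<times> nat \<times> nat) set \<Rightarrow> bool" where
  "admissible_delivery A n cap s D \<longleftrightarrow>
     D \<subseteq> sent_glob A n s \<and>
     (\<forall>u v m. (u, v, m) \<in> sent_glob A n s \<and>
              real (card (set (glob A n (s u)))) \<le> cap \<and>
              real (card {(u', m'). (u', v, m') \<in> sent_glob A n s}) \<le> cap
              \<longrightarrow> (u, v, m) \<in> D)"

text \<open>
  A run: S r v is the state of node v after r rounds. In every round each node
  sends LOCAL messages to all its neighbours (all delivered) and global
  messages, of which an admissible set is delivered (chosen by an adversary).
\<close>
definition hybrid_run ::
  "('st, 'lm) hybrid_alg \<Rightarrow> real \<Rightarrow> nat \<Rightarrow> (nat \<times> nat) set \<Rightarrow> (nat \<Rightarrow> nat \<Rightarrow> nat)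
     \<Rightarrow> (nat \<Rightarrow> nat \<Rightarrow> 'st) \<Rightarrow> bool" where
  "hybrid_run A cap n E w S \<longleftrightarrow>
     (\<forall>v\<in>{1..n}. S 0 v = init A n v {(u, w v u) | u. (v, u) \<in> E}) \<and>
     (\<forall>r. \<exists>D. admissible_delivery A n cap (S r) D \<and>
          (\<forall>v\<in>{1..n}. S (Suc r) v =
             trans A n (S r v)
               {(u, loc A n (S r u) v) | u. (u, v) \<in> E}
               {(u, m). (u, v, m) \<in> D}))"

end

theory Submission
  imports Defs "HOL-Library.Countable" "HOL-Library.Nat_Bijection"
begin

text \<open>
  Let s be about sqrt n. Every node floods all it knows over the local edges, and in every round
  it sends and is addressed by at most one global message, so that the adversary never gets to
  drop anything. First, s global minimum computations elect greedily a maximal set of rulers at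
  pairwise distance more than 2s; their balls of radius s are disjoint and have more than s nodes
  each, so at most s rulers are found. Each edge is a token owned by its endpoint of smaller
  degree, so that nobody owns more than sqrt (card E) tokens. Prefix sums over the identifiers
  number the tokens consecutively, and the owners spread them evenly over all nodes,
  polylogarithmically many per node. The first s nodes of each ball divide the n holders among
  themselves and fetch their tokens, each ruler starting at a different offset to avoid
  collisions. As every node is within distance 3s of such a complete set of fetchers, flooding
  for 3s more rounds finishes. A ball with fewer than s nodes is the whole graph, where flooding
  alone suffices.
\<close>

section \<open>Neighbourhoods\<close>

text \<open>The closed ball of radius \<open>k\<close> around \<open>r\<close> in hop
  distance.\<close>

fun nbhd :: "('a \<times> 'a) set \<Rightarrow> 'a \<Rightarrow> nat \<Rightarrow> 'a set" where
  "nbhd R r 0 = {r}"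
| "nbhd R r (Suc k) = nbhd R r k \<union> R `` nbhd R r k"

lemma nbhd_mono: "j \<le> k \<Longrightarrow> nbhd R r j \<subseteq> nbhd R r k"
  by (induction k) (auto simp: le_Suc_eq)

lemma nbhd_self: "r \<in> nbhd R r k"
  using nbhd_mono[of 0 k] by auto

lemma nbhd_trans: "y \<in> nbhd R x k \<Longrightarrow> x \<in> nbhd R r j \<Longrightarrow> y \<in> nbhd R r (j + k)"
  by (induction k arbitrary: y) auto

lemma nbhd_sym:
  assumes "sym R" and "x \<in> nbhd R r k"
  shows "r \<in> nbhd R x k"
  using assms(2)
proof (induction k arbitrary: x)
  case (Suc k)
  show ?case
  proof (cases "x \<in> nbhd R r k")
    case False
    then obtain y where y: "y \<in> nbhd R r k" "(y, x) \<in> R"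
      using Suc.prems by auto
    then have "y \<in> nbhd R x 1"
      using \<open>sym R\<close> by (auto dest: symD)
    with Suc.IH[OF y(1)] show ?thesis
      using nbhd_trans[of r R y k x 1] by simp
  qed (use Suc.IH in auto)
qed auto

lemma nbhd_subset: "R \<subseteq> V \<times> V \<Longrightarrow> r \<in> V \<Longrightarrow> nbhd R r k \<subseteq> V"
  by (induction k) auto

text \<open>Meant for \<open>R'\<close> being the edges that a node has learned so far: a partial
  view containing all edges that leave members of a ball determines that ball correctly.\<close>

lemma nbhd_local:
  assumes "R' \<subseteq> R" and "\<And>a b. a \<in> nbhd R r k \<Longrightarrow> (a, b) \<in> R \<Longrightarrow> (a, b) \<in> R'"
  shows "nbhd R' r k = nbhd R r k"
  using assms(2)
proof (induction k)
  case (Suc k)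
  have "nbhd R' r k = nbhd R r k"
    using Suc by auto
  moreover have "R' `` nbhd R r k = R `` nbhd R r k"
    using Suc.prems assms(1) by (fastforce simp: Image_iff)
  ultimately show ?case by simp
qed auto

text \<open>As long as some node is missing, connectivity prevents the ball from being closed under
  \<open>R\<close>, so each increment of the radius adds at least one node.\<close>

lemma card_nbhd_gt:
  assumes R: "R \<subseteq> V \<times> V" "finite V" "r \<in> V"
    and conn: "\<And>y. y \<in> V \<Longrightarrow> (r, y) \<in> R\<^sup>*"
    and y: "y \<in> V" "y \<notin> nbhd R r k"
  shows "k < card (nbhd R r k)"
  using y(2)
proof (induction k)
  case (Suc k)
  have "nbhd R r k \<noteq> nbhd R r (Suc k)"
  proof
    assume "nbhd R r k = nbhd R r (Suc k)"
    then have closed: "R `` nbhd R r k \<subseteq> nbhd R r k" by auto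
    have "z \<in> nbhd R r k" if "(r, z) \<in> R\<^sup>*" for z
      using that by (induction rule: rtrancl_induct) (use closed nbhd_self[of r R k] in auto)
    with conn[OF y(1)] Suc.prems show False by auto
  qed
  moreover have "finite (nbhd R r (Suc k))"
    using nbhd_subset[OF R(1,3)] R(2) finite_subset by blast
  ultimately have "card (nbhd R r k) < card (nbhd R r (Suc k))"
    by (intro psubset_card_mono) auto
  with Suc show ?case by auto
qed auto

section \<open>Cyclic shifts of the node identifiers\<close>

text \<open>Addition modulo \<open>n\<close>, moved from \<open>{0..n-1}\<close> to the identifiers
  \<open>{1..n}\<close>. Being a permutation, it gives an addressing scheme without
  collisions.\<close>

definition shift :: "nat \<Rightarrow> nat \<Rightarrow> nat \<Rightarrow> nat" where
  "shift n k u = (u - 1 + k) mod n + 1"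

lemma shift_in: "0 < n \<Longrightarrow> shift n k u \<in> {1..n}"
  by (auto simp: shift_def Suc_le_eq)

lemma shift_0: "u \<in> {1..n} \<Longrightarrow> shift n 0 u = u"
  by (auto simp: shift_def)

lemma shift_shift: "shift n k (shift n l u) = shift n (l + k) u"
  by (simp add: shift_def mod_add_left_eq add.assoc)

lemma shift_inj:
  assumes "u \<in> {1..n}" "v \<in> {1..n}" "shift n k u = shift n k v"
  shows "u = v"
proof -
  \<comment> \<open>The inverse permutation: the two amounts add up to a multiple of
    \<open>n\<close>.\<close>
  have 1: "shift n (n - k mod n) (shift n k a) = a" if "a \<in> {1..n}" for a
  proof -
    have "k mod n < n" using that by auto
    then have "k + (n - k mod n) = n * (k div n) + n"
      using mult_div_mod_eq[of n k] by linarith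
    then have *: "a - 1 + (k + (n - k mod n)) = (a - 1) + n * (k div n + 1)"
      by simp
    have "(a - 1 + (k + (n - k mod n))) mod n = a - 1"
      unfolding * mod_mult_self2 using that by auto
    moreover have "1 \<le> a" using that by simp
    ultimately show ?thesis unfolding shift_shift unfolding shift_def by linarith
  qed
  from assms 1[of u] 1[of v] show ?thesis by metis
qed

lemma shift_reach:
  assumes "u \<in> {1..n}" "v \<in> {1..n}"
  obtains k where "k < n" "shift n k u = v"
proof (cases "u \<le> v")
  case True
  with assms show ?thesis by (intro that[of "v - u"]) (auto simp: shift_def)
next
  case False
  with assms show ?thesis by (intro that[of "n + v - u"]) (auto simp: shift_def mod_if)
qed

section \<open>Ranks in finite sets of numbers\<close>

lemma rank_less:
  fixes N :: "nat set"
  assumes "finite N" "y \<in> N" "y < z"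
  shows "card {x \<in> N. x < y} < card {x \<in> N. x < z}"
  by (rule psubset_card_mono) (use assms in auto)

lemma rank_inj:
  fixes N :: "nat set"
  assumes "finite N" "y \<in> N" "z \<in> N" "card {x \<in> N. x < y} = card {x \<in> N. x < z}"
  shows "y = z"
  using rank_less[OF assms(1,2), of z] rank_less[OF assms(1,3), of y] assms(4)
  by (cases y z rule: linorder_cases) auto

text \<open>The rank maps \<open>N\<close> injectively into \<open>{..<card N}\<close>, hence onto
  it by counting.\<close>

lemma rank_surj:
  fixes N :: "nat set"
  assumes "finite N" "i < card N"
  obtains y where "y \<in> N" "card {x \<in> N. x < y} = i"
proof -
  let ?f = "\<lambda>y. card {x \<in> N. x < y}"
  have "?f ` N \<subseteq> {..<card N}"
    using assms(1) by (auto intro!: psubset_card_mono)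
  moreover have "inj_on ?f N"
    using rank_inj[OF assms(1)] by (auto intro!: inj_onI)
  then have "card (?f ` N) = card {..<card N}" by (simp add: card_image)
  ultimately have "?f ` N = {..<card N}" by (intro card_subset_eq) auto
  then have "i \<in> ?f ` N" using assms(2) by simp
  with that show ?thesis by blast
qed

section \<open>The algorithm\<close>

definition sq :: "nat \<Rightarrow> nat" where "sq n = nat \<lceil>sqrt (real n)\<rceil>"
definition lg :: "nat \<Rightarrow> nat" where "lg n = nat \<lceil>log 2 (real n)\<rceil>"

section \<open>Tokens, their encoding and the node states\<close>

definition edges :: "(nat \<times> nat \<times> nat) set \<Rightarrow> (nat \<times> nat) set" where
  "edges X = {(a, b). \<exists>c. (a, b, c) \<in> X}"

text \<open>Degrees are measured in the view \<open>X\<close>. In a tie both endpoints own the edge,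
  each in its own orientation, so the edge merely yields two tokens.\<close>

definition owned :: "(nat \<times> nat \<times> nat) set \<Rightarrow> nat \<Rightarrow> (nat \<times> nat \<times> nat) set" where
  "owned X u = {(a, b, c) \<in> X. a = u \<and> card (edges X `` {u}) \<le> card (edges X `` {b})}"

text \<open>The order is arbitrary but depends on the owned set alone, so a partial view and the
  full topology give the same list once they agree on that set.\<close>

definition tokens :: "(nat \<times> nat \<times> nat) set \<Rightarrow> nat \<Rightarrow> (nat \<times> nat \<times> nat) list" where
  "tokens X u = (SOME xs. distinct xs \<and> set xs = owned X u)"

definition enc_token :: "nat \<times> nat \<times> nat \<Rightarrow> nat" where
  "enc_token = (\<lambda>(a, b, c). prod_encode (a, prod_encode (b, c)))"

definition dec_token :: "nat \<Rightarrow> nat \<times> nat \<times> nat" where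
  "dec_token m = (let (a, r) = prod_decode m in (a, prod_decode r))"

lemma dec_enc_token [simp]: "dec_token (enc_token x) = x"
  by (cases x) (simp add: dec_token_def enc_token_def)

definition enlist :: "'a set \<Rightarrow> 'a list" where
  "enlist X = (SOME xs. set xs = X)"

lemma set_enlist [simp]: "finite X \<Longrightarrow> set (enlist X) = X"
  unfolding enlist_def by (rule someI_ex) (rule finite_list)

text \<open>Lists instead of sets keep the type countable, so that a state can be coded as one
  natural number. \<open>agg\<close> is the running minimum of an election, \<open>psum\<close> a
  partial prefix sum, \<open>held\<close> stores encoded tokens with their slots, and
  \<open>asker\<close> is the node to be answered, 0 if there is none.\<close>

datatype node_state = Node
  (clock: nat) (self: nat) (known: "(nat \<times> nat \<times> nat) list") (rulers: "nat list")
  (agg: nat) (psum: nat) (held: "(nat \<times> nat) list") (asker: nat)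

instance node_state :: countable
  by countable_datatype

abbreviation known_set :: "node_state \<Rightarrow> (nat \<times> nat \<times> nat) set" where
  "known_set s \<equiv> set (known s)"

definition covered :: "(nat \<times> nat) set \<Rightarrow> nat \<Rightarrow> nat list \<Rightarrow> nat \<Rightarrow> bool" where
  "covered R s rs v \<longleftrightarrow> (\<exists>r\<in>set rs. r \<in> nbhd R v (2 * s))"

text \<open>
  End of initial flooding, of the election of the rulers, of the prefix sums, of the spreading
  of the tokens and of the fetching of the tokens. Q is an upper bound for card E / n.
\<close>

definition t0 :: "nat \<Rightarrow> nat" where "t0 n = 3 * sq n"
definition t1 :: "nat \<Rightarrow> nat" where "t1 n = t0 n + sq n * lg n"
definition t2 :: "nat \<Rightarrow> nat" where "t2 n = t1 n + lg n"
definition t3 :: "nat \<Rightarrow> nat \<Rightarrow> nat" where "t3 Q n = t2 n + Q * sq n * Q"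
definition t4 :: "nat \<Rightarrow> nat \<Rightarrow> nat" where "t4 Q n = t3 Q n + 2 * (sq n * Q)"

text \<open>\<open>n + 1\<close> exceeds every identifier and stands for no candidacy; it is the
  global minimum only if every node is covered.\<close>

definition candidate :: "nat \<Rightarrow> node_state \<Rightarrow> nat" where
  "candidate n s = (if covered (edges (known_set s)) (sq n) (rulers s) (self s) then n + 1 else self s)"

text \<open>The election proceeds in blocks of \<open>lg n\<close> rounds, each electing at most one
  ruler; the running minimum restarts with every block.\<close>

definition cur_agg :: "nat \<Rightarrow> node_state \<Rightarrow> nat" where
  "cur_agg n s = (if (clock s - t0 n) mod lg n = 0 then candidate n s else agg s)"

definition my_tokens :: "node_state \<Rightarrow> (nat \<times> nat \<times> nat) list" where
  "my_tokens s = tokens (known_set s) (self s)"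

definition cur_psum :: "nat \<Rightarrow> node_state \<Rightarrow> nat" where
  "cur_psum n s = (if clock s = t1 n then length (my_tokens s) else psum s)"

text \<open>The node v is number i among the fetchers of ruler number c.\<close>

definition is_role :: "(nat \<times> nat) set \<Rightarrow> nat \<Rightarrow> nat list \<Rightarrow> nat \<Rightarrow> nat \<Rightarrow> nat \<Rightarrow> bool" where
  "is_role R s rs v c i \<longleftrightarrow> c < length rs \<and> rs ! c \<in> nbhd R v s \<and>
     i = card {x \<in> nbhd R (rs ! c) s. x < v} \<and> i < s"

text \<open>Doubling around the cycle of identifiers: round \<open>j\<close> of a block shifts by
  \<open>2 ^ j\<close>, so \<open>lg n\<close> rounds carry every candidate to every node.\<close>

definition send_rulers :: "nat \<Rightarrow> node_state \<Rightarrow> (nat \<times> nat) list" where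
  "send_rulers n s = [(shift n (2 ^ ((clock s - t0 n) mod lg n)) (self s), cur_agg n s)]"

text \<open>Parallel prefix sums by doubling, this time without wrap-around.\<close>

definition send_psum :: "nat \<Rightarrow> node_state \<Rightarrow> (nat \<times> nat) list" where
  "send_psum n s = (let d = self s + 2 ^ (clock s - t1 n) in if d \<le> n then [(d, cur_psum n s)] else [])"

text \<open>
  The j-th token of a node, with global number g, is sent in slot j * Q + g mod Q to the node
  g div Q + 1: two messages in the same slot to the same node would carry the same number.
\<close>

definition send_spread :: "nat \<Rightarrow> nat \<Rightarrow> node_state \<Rightarrow> (nat \<times> nat) list" where
  "send_spread Q n s = (let a = clock s - t2 n; j = a div Q; T = my_tokens s; g = psum s - length T + j
     in if j < length T \<and> g mod Q = a mod Q then [(g div Q + 1, enc_token (T ! j))] else [])"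

text \<open>Fetcher \<open>i\<close> is responsible for the block of \<open>sq n\<close> holders
  starting at \<open>i * sq n + 1\<close>. It stays \<open>Q\<close> requests at each holder, one
  per slot, and walks cyclically through the block from offset \<open>c\<close>, so that equal
  fetchers of different rulers are never at the same holder. The request carries no content, because
  the clock determines the slot.\<close>

definition send_ask :: "nat \<Rightarrow> nat \<Rightarrow> node_state \<Rightarrow> (nat \<times> nat) list" where
  "send_ask Q n s = (let a = (clock s - t3 Q n) div 2; P = is_role (edges (known_set s)) (sq n) (rulers s) (self s)
     in if \<exists>c i. P c i then
       (let (c, i) = (SOME (c, i). P c i) in [(i * sq n + (c + a div Q) mod sq n + 1, 0)]) else [])"

definition send_reply :: "nat \<Rightarrow> nat \<Rightarrow> node_state \<Rightarrow> (nat \<times> nat) list" where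
  "send_reply Q n s = (let p = (clock s - t3 Q n) div 2 mod Q
     in if asker s \<noteq> 0 \<and> (\<exists>m. (p, m) \<in> set (held s))
        then [(asker s, SOME m. (p, m) \<in> set (held s))] else [])"

definition send :: "nat \<Rightarrow> nat \<Rightarrow> node_state \<Rightarrow> (nat \<times> nat) list" where
  "send Q n s = (let t = clock s in
     if t < t0 n then []
     else if t < t1 n then send_rulers n s
     else if t < t2 n then send_psum n s
     else if t < t3 Q n then send_spread Q n s
     else if t < t4 Q n then (if even (t - t3 Q n) then send_ask Q n s else send_reply Q n s)
     else [])"

text \<open>A minimum is recorded as a ruler only in the last round of a block, and only if it is a
  real identifier. \<open>asker\<close> is overwritten in every round and thus refers to the round
  just before.\<close>

definition receive ::
  "nat \<Rightarrow> nat \<Rightarrow> node_state \<Rightarrow> (nat \<times> nat \<times> nat) set \<Rightarrow> (nat \<times> nat) set \<Rightarrow> node_state" where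
  "receive Q n s F G = (let t = clock s; M = snd ` G; x = Min (insert (cur_agg n s) M) in
     Node (Suc t) (self s)
       (enlist (known_set s \<union> F \<union>
          (if t3 Q n \<le> t \<and> t < t4 Q n \<and> odd (t - t3 Q n) then dec_token ` M else {})))
       (if t0 n \<le> t \<and> t < t1 n \<and> Suc (t - t0 n) mod lg n = 0 \<and> x \<le> n then rulers s @ [x] else rulers s)
       x
       (if t1 n \<le> t \<and> t < t2 n then cur_psum n s + \<Sum>M else psum s)
       (if t2 n \<le> t \<and> t < t3 Q n then map (Pair ((t - t2 n) mod Q)) (enlist M) @ held s else held s)
       (if G = {} then 0 else fst (SOME g. g \<in> G)))"

text \<open>\<open>Q\<close> is a function of \<open>n\<close> alone, so every node can evaluate it.
  The filter enforces the message size in arbitrary states. The output adds reversed triples, since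
  an edge may be learned from its owner's side only.\<close>

definition topology_alg :: "(nat \<Rightarrow> nat) \<Rightarrow> nat \<Rightarrow> (nat list, nat list) hybrid_alg" where
  "topology_alg Q C = \<lparr>
     init = (\<lambda>n v N. [to_nat (Node 0 v (enlist ((\<lambda>(u, c). (v, u, c)) ` N)) [] 0 0 [] 0)]),
     loc = (\<lambda>n s u. s),
     glob = (\<lambda>n s. filter (\<lambda>(v, m). m < n ^ C) (send (Q n) n (from_nat (hd s)))),
     trans = (\<lambda>n s L G. [to_nat (receive (Q n) n (from_nat (hd s))
        (\<Union>(u, l)\<in>L. known_set (from_nat (hd l))) G)]),
     out = (\<lambda>n s. let X = known_set (from_nat (hd s)) in X \<union> {(b, a, c). (a, b, c) \<in> X})\<rparr>"

lemma topology_alg_wf: "hybrid_wf (topology_alg Q C) C"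
  by (auto simp: hybrid_wf_def topology_alg_def)

section \<open>Runs of the algorithm\<close>

lemma tokens_props:
  assumes "finite X"
  shows "distinct (tokens X u)" "set (tokens X u) = owned X u"
proof -
  have "finite (owned X u)"
    using assms by (rule finite_subset[rotated]) (auto simp: owned_def)
  then obtain xs where "distinct xs \<and> set xs = owned X u"
    using finite_distinct_list by blast
  then have "distinct (tokens X u) \<and> set (tokens X u) = owned X u"
    unfolding tokens_def by (rule someI)
  then show "distinct (tokens X u)" "set (tokens X u) = owned X u" by auto
qed

lemma length_send: "length (send Q n s) \<le> 1"
  by (auto simp: send_def send_rulers_def send_psum_def send_spread_def send_ask_def
      send_reply_def Let_def split: prod.splits)

lemma send_unique:
  assumes "x \<in> set (send Q n s)" "y \<in> set (send Q n s)"
  shows "x = y"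
proof -
  obtain z where "send Q n s = [] \<or> send Q n s = [z]"
    using length_send[of Q n s] by (cases "send Q n s") auto
  with assms show ?thesis by auto
qed

text \<open>One run against an arbitrary adversary. \<open>enc_bound\<close> guarantees that the
  size filter discards no token.\<close>

locale topology_run =
  fixes n :: nat and E :: "(nat \<times> nat) set" and w :: "nat \<Rightarrow> nat \<Rightarrow> nat" and W :: nat
    and Qf :: "nat \<Rightarrow> nat" and C :: nat and S :: "nat \<Rightarrow> nat \<Rightarrow> nat list"
  assumes n2: "2 \<le> n"
    and wg: "weighted_graph n E w W"
    and conn: "graph_connected n E"
    and card_E: "card E \<le> Qf n * n"
    and Q_pos: "0 < Qf n"
    and C3: "3 \<le> C"
    and enc_bound: "\<And>x. x \<in> topology E w \<Longrightarrow> enc_token x < n ^ C"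
    and run: "hybrid_run (topology_alg Qf C) (real C * log 2 (real n)) n E w S"
begin

definition V :: "nat set" where "V = {1..n}"
abbreviation "Q \<equiv> Qf n"
abbreviation "s \<equiv> sq n"
abbreviation "L \<equiv> lg n"
abbreviation "Top \<equiv> topology E w"

definition st :: "nat \<Rightarrow> nat \<Rightarrow> node_state" where
  "st r v = from_nat (hd (S r v))"

text \<open>A run only asserts that some admissible delivery exists in each round; choosing one
  makes the received messages a function of round and node.\<close>

definition D :: "nat \<Rightarrow> (nat \<times> nat \<times> nat) set" where
  "D r = (SOME D. admissible_delivery (topology_alg Qf C) n (real C * log 2 (real n)) (S r) D \<and>
          (\<forall>v\<in>V. S (Suc r) v = trans (topology_alg Qf C) n (S r v)
               {(u, loc (topology_alg Qf C) n (S r u) v) | u. (u, v) \<in> E} {(u, m). (u, v, m) \<in> D}))"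

definition G :: "nat \<Rightarrow> nat \<Rightarrow> (nat \<times> nat) set" where
  "G r v = {(u, m). (u, v, m) \<in> D r}"

lemma D_props:
  "admissible_delivery (topology_alg Qf C) n (real C * log 2 (real n)) (S r) (D r)"
  "v \<in> V \<Longrightarrow> S (Suc r) v = trans (topology_alg Qf C) n (S r v)
     {(u, loc (topology_alg Qf C) n (S r u) v) | u. (u, v) \<in> E} (G r v)"
proof -
  have "admissible_delivery (topology_alg Qf C) n (real C * log 2 (real n)) (S r) (D r) \<and>
          (\<forall>v\<in>V. S (Suc r) v = trans (topology_alg Qf C) n (S r v)
               {(u, loc (topology_alg Qf C) n (S r u) v) | u. (u, v) \<in> E} {(u, m). (u, v, m) \<in> D r})"
    unfolding D_def by (rule someI_ex) (use run in \<open>auto simp: hybrid_run_def V_def\<close>)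
  then show "admissible_delivery (topology_alg Qf C) n (real C * log 2 (real n)) (S r) (D r)"
    "v \<in> V \<Longrightarrow> S (Suc r) v = trans (topology_alg Qf C) n (S r v)
     {(u, loc (topology_alg Qf C) n (S r u) v) | u. (u, v) \<in> E} (G r v)"
    unfolding G_def by auto
qed

section \<open>Basic facts on nodes, edges and parameters\<close>

lemma finite_V [simp]: "finite V" and card_V [simp]: "card V = n"
  by (auto simp: V_def)

lemma V_nonempty: "V \<noteq> {}" and V_pos: "v \<in> V \<Longrightarrow> 0 < v" and V_le: "v \<in> V \<Longrightarrow> v \<le> n"
  using n2 by (auto simp: V_def)

lemmas shift_V = shift_in[of n, folded V_def]
  and shift_0_V = shift_0[of _ n, folded V_def]
  and shift_inj_V = shift_inj[of _ n, folded V_def]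
  and shift_reach_V = shift_reach[of _ n, folded V_def]

lemma E_V: "E \<subseteq> V \<times> V" and sym_E: "sym E"
  using wg by (auto simp: weighted_graph_def sym_def V_def)

lemma w_sym: "(a, b) \<in> E \<Longrightarrow> w a b = w b a"
  using wg by (auto simp: weighted_graph_def)

lemma finite_E: "finite E"
  using E_V finite_V finite_subset by blast

lemma finite_Top: "finite Top"
proof -
  have "Top = (\<lambda>(u, v). (u, v, w u v)) ` E" by (auto simp: topology_def)
  with finite_E show ?thesis by simp
qed

lemma edges_Top: "edges Top = E"
  by (auto simp: edges_def topology_def)

lemma sq_pos: "0 < s" and n_le_sq: "n \<le> s * s"
proof -
  have "sqrt (real n) > 0" using n2 by simp
  then show "0 < s" by (simp add: sq_def)
  have "sqrt (real n) \<le> real s" by (simp add: sq_def real_nat_ceiling_ge)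
  then have "real n \<le> real s * real s"
    using mult_mono[of "sqrt (real n)" "real s" "sqrt (real n)" "real s"] by simp
  then show "n \<le> s * s" by (metis of_nat_le_iff of_nat_mult)
qed

lemma log_ge_1: "1 \<le> log 2 (real n)"
  using n2 by (simp add: le_log_iff)

lemma lg_pos: "0 < L" and n_le_lg: "n \<le> 2 ^ L"
proof -
  show "0 < L" using log_ge_1 by (simp add: lg_def)
  have "log 2 (real n) \<le> real L" by (simp add: lg_def real_nat_ceiling_ge)
  then have "real n \<le> 2 powr real L" using n2 by (simp add: log_le_iff)
  then have "real n \<le> real (2 ^ L)" by (simp add: powr_realpow)
  then show "n \<le> 2 ^ L" by (simp only: of_nat_le_iff)
qed

section \<open>Decoded states and message delivery\<close>

lemma st_0:
  "v \<in> V \<Longrightarrow> st 0 v = Node 0 v (enlist {(v, u, w v u) | u. (v, u) \<in> E}) [] 0 0 [] 0"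
proof -
  assume "v \<in> V"
  then have "S 0 v = init (topology_alg Qf C) n v {(u, w v u) | u. (v, u) \<in> E}"
    using run by (auto simp: hybrid_run_def V_def)
  moreover have "(\<lambda>(u, c). (v, u, c)) ` {(u, w v u) | u. (v, u) \<in> E} = {(v, u, w v u) | u. (v, u) \<in> E}"
    by auto
  ultimately show ?thesis by (simp add: st_def topology_alg_def)
qed

lemma st_Suc:
  assumes "v \<in> V"
  shows "st (Suc r) v = receive Q n (st r v) (\<Union>u\<in>{u. (u, v) \<in> E}. known_set (st r u)) (G r v)"
proof -
  have "(\<Union>(u, l)\<in>{(u, S r u) |u. (u, v) \<in> E}. known_set (from_nat (hd l)))
      = (\<Union>u\<in>{u. (u, v) \<in> E}. known_set (st r u))"
    by (auto simp: st_def)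
  then show ?thesis
    unfolding st_def using D_props(2)[OF assms, of r] by (simp add: topology_alg_def st_def)
qed

lemma sent_iff:
  "(u, v, m) \<in> sent_glob (topology_alg Qf C) n (S r) \<longleftrightarrow>
     u \<in> V \<and> (v, m) \<in> set (send Q n (st r u)) \<and> m < n ^ C"
  by (auto simp: sent_glob_def topology_alg_def st_def V_def)

lemma G_sent: "(u, m) \<in> G r v \<Longrightarrow> u \<in> V \<and> (v, m) \<in> set (send Q n (st r u))"
  using D_props(1)[of r] sent_iff unfolding G_def admissible_delivery_def by blast

text \<open>Reliable delivery: every node sends at most one message anyway, so if no target is
  addressed by two senders, the capacity is respected on both sides. Each phase below establishes
  \<open>inj\<close> for its own addressing scheme.\<close>

lemma G_all:
  assumes inj: "\<And>u u' v m m'. u \<in> V \<Longrightarrow> u' \<in> V \<Longrightarrow> (v, m) \<in> set (send Q n (st r u)) \<Longrightarrow>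
      (v, m') \<in> set (send Q n (st r u')) \<Longrightarrow> u = u'"
    and sent: "u \<in> V" "(v, m) \<in> set (send Q n (st r u))" "m < n ^ C"
  shows "(u, m) \<in> G r v"
proof -
  have "1 * 1 \<le> real C * log 2 (real n)"
    using C3 log_ge_1 by (intro mult_mono) auto
  then have cap: "1 \<le> real C * log 2 (real n)" by simp
  let ?g = "glob (topology_alg Qf C) n (S r u)"
  have "length ?g \<le> 1"
    using order_trans[OF length_filter_le length_send] by (simp add: topology_alg_def)
  then have "card (set ?g) \<le> 1" using card_length order_trans by blast
  then have 1: "real (card (set ?g)) \<le> real C * log 2 (real n)" using cap by linarith
  have "{(u', m'). (u', v, m') \<in> sent_glob (topology_alg Qf C) n (S r)} \<subseteq> {(u, m)}"
  proof clarsimp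
    fix u' m' assume "(u', v, m') \<in> sent_glob (topology_alg Qf C) n (S r)"
    then have u': "u' \<in> V" "(v, m') \<in> set (send Q n (st r u'))" by (auto simp: sent_iff)
    then have "u' = u" using inj sent by blast
    with u' sent send_unique show "u' = u \<and> m' = m" by blast
  qed
  then have "card {(u', m'). (u', v, m') \<in> sent_glob (topology_alg Qf C) n (S r)} \<le> card {(u, m)}"
    by (intro card_mono) auto
  then have 2: "real (card {(u', m'). (u', v, m') \<in> sent_glob (topology_alg Qf C) n (S r)})
      \<le> real C * log 2 (real n)"
    using cap by simp
  have "(u, v, m) \<in> sent_glob (topology_alg Qf C) n (S r)"
    using sent by (simp add: sent_iff)
  with 1 2 show ?thesis
    using D_props(1)[of r] unfolding G_def admissible_delivery_def by blast
qed

lemma finite_G: "finite (G r v)"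
proof (rule finite_subset)
  show "G r v \<subseteq> V \<times> (\<Union>u\<in>V. snd ` set (send Q n (st r u)))"
    using G_sent by (force simp: image_iff)
qed auto

section \<open>Update rules for the state components\<close>

lemma clock_st [simp]: "v \<in> V \<Longrightarrow> clock (st r v) = r"
  by (induction r) (auto simp: st_0 st_Suc receive_def Let_def)

lemma self_st [simp]: "v \<in> V \<Longrightarrow> self (st r v) = v"
  by (induction r) (auto simp: st_0 st_Suc receive_def Let_def)

lemma known_Suc:
  assumes "v \<in> V"
  shows "known_set (st (Suc r) v) = known_set (st r v) \<union> (\<Union>u\<in>{u. (u, v) \<in> E}. known_set (st r u)) \<union>
    (if t3 Q n \<le> r \<and> r < t4 Q n \<and> odd (r - t3 Q n) then dec_token ` snd ` G r v else {})"
proof -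
  have "finite {u. (u, v) \<in> E}"
    by (rule finite_subset[of _ V]) (use E_V in auto)
  with finite_G show ?thesis
    using assms by (simp add: st_Suc receive_def Let_def)
qed

lemma held_Suc:
  assumes "v \<in> V"
  shows "set (held (st (Suc r) v)) = set (held (st r v)) \<union>
    (if t2 n \<le> r \<and> r < t3 Q n then Pair ((r - t2 n) mod Q) ` snd ` G r v else {})"
  using assms finite_G by (auto simp: st_Suc receive_def Let_def)

lemma rulers_Suc:
  assumes "v \<in> V"
  shows "rulers (st (Suc r) v) = (if t0 n \<le> r \<and> r < t1 n \<and> Suc (r - t0 n) mod L = 0 \<and> agg (st (Suc r) v) \<le> n
     then rulers (st r v) @ [agg (st (Suc r) v)] else rulers (st r v))"
  using assms by (simp add: st_Suc receive_def Let_def)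

lemma agg_Suc: "v \<in> V \<Longrightarrow> agg (st (Suc r) v) = Min (insert (cur_agg n (st r v)) (snd ` G r v))"
  by (simp add: st_Suc receive_def Let_def)

lemma psum_Suc: "v \<in> V \<Longrightarrow> psum (st (Suc r) v) =
    (if t1 n \<le> r \<and> r < t2 n then cur_psum n (st r v) + \<Sum>(snd ` G r v) else psum (st r v))"
  by (simp add: st_Suc receive_def Let_def)

lemma asker_Suc: "v \<in> V \<Longrightarrow> asker (st (Suc r) v) = (if G r v = {} then 0 else fst (SOME g. g \<in> G r v))"
  by (simp add: st_Suc receive_def Let_def)

lemma phases: "t0 n \<le> t1 n" "t1 n \<le> t2 n" "t2 n \<le> t3 Q n" "t3 Q n \<le> t4 Q n"
  by (auto simp: t1_def t2_def t3_def t4_def)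

lemma send_phase:
  assumes "v \<in> V"
  shows
    "t0 n \<le> t \<Longrightarrow> t < t1 n \<Longrightarrow> send Q n (st t v) = send_rulers n (st t v)"
    "t1 n \<le> t \<Longrightarrow> t < t2 n \<Longrightarrow> send Q n (st t v) = send_psum n (st t v)"
    "t2 n \<le> t \<Longrightarrow> t < t3 Q n \<Longrightarrow> send Q n (st t v) = send_spread Q n (st t v)"
    "t3 Q n \<le> t \<Longrightarrow> t < t4 Q n \<Longrightarrow> even (t - t3 Q n) \<Longrightarrow> send Q n (st t v) = send_ask Q n (st t v)"
    "t3 Q n \<le> t \<Longrightarrow> t < t4 Q n \<Longrightarrow> odd (t - t3 Q n) \<Longrightarrow> send Q n (st t v) = send_reply Q n (st t v)"
  using assms phases by (auto simp: send_def Let_def)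

text \<open>Known triples and held tokens need a joint induction: held tokens are taken from the
  senders' known triples, and replies turn held tokens into known triples.\<close>

lemma sound:
  "v \<in> V \<Longrightarrow> known_set (st r v) \<subseteq> Top \<and> snd ` set (held (st r v)) \<subseteq> enc_token ` Top"
proof (induction r arbitrary: v)
  case 0
  have "{(v, u, w v u) |u. (v, u) \<in> E} \<subseteq> Top" by (auto simp: topology_def)
  moreover from this have "finite {(v, u, w v u) |u. (v, u) \<in> E}" using finite_Top finite_subset by blast
  ultimately show ?case using 0 by (simp add: st_0)
next
  case (Suc r)
  have spread: "m \<in> enc_token ` Top" if "t2 n \<le> r" "r < t3 Q n" "(u, m) \<in> G r v" for u m
  proof -
    have u: "u \<in> V" "(v, m) \<in> set (send_spread Q n (st r u))"
      using G_sent[OF that(3)] send_phase that by auto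
    then obtain j where "m = enc_token (my_tokens (st r u) ! j)" "j < length (my_tokens (st r u))"
      by (auto simp: send_spread_def Let_def split: if_splits)
    then have "m \<in> enc_token ` set (my_tokens (st r u))" by auto
    moreover have "set (my_tokens (st r u)) \<subseteq> known_set (st r u)"
      unfolding my_tokens_def by (subst tokens_props) (auto simp: owned_def)
    ultimately show ?thesis using Suc.IH[OF u(1)] by blast
  qed
  have reply: "dec_token m \<in> Top" if "t3 Q n \<le> r" "r < t4 Q n" "odd (r - t3 Q n)" "(u, m) \<in> G r v" for u m
  proof -
    have u: "u \<in> V" "(v, m) \<in> set (send_reply Q n (st r u))"
      using G_sent[OF that(4)] send_phase that by auto
    define p where "p = (r - t3 Q n) div 2 mod Q"
    have "\<exists>m. (p, m) \<in> set (held (st r u))" "m = (SOME m. (p, m) \<in> set (held (st r u)))"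
      using u by (auto simp: send_reply_def Let_def p_def split: if_splits)
    then have "(p, m) \<in> set (held (st r u))" using someI_ex by metis
    then show ?thesis using Suc.IH[OF u(1)] by force
  qed
  have "u \<in> V" if "(u, v) \<in> E" for u using that E_V by auto
  then have "(\<Union>u\<in>{u. (u, v) \<in> E}. known_set (st r u)) \<subseteq> Top" using Suc.IH by blast
  moreover have "dec_token ` snd ` G r v \<subseteq> Top" if "t3 Q n \<le> r" "r < t4 Q n" "odd (r - t3 Q n)"
    using reply[OF that] by (auto simp del: split_paired_Ex)
  ultimately have "known_set (st (Suc r) v) \<subseteq> Top"
    unfolding known_Suc[OF Suc.prems] using Suc.IH[OF Suc.prems] by (simp only: Un_subset_iff split: if_split) simp
  moreover have "snd ` Pair p ` snd ` G r v \<subseteq> enc_token ` Top" if "t2 n \<le> r" "r < t3 Q n" for p :: nat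
  proof -
    have "snd ` Pair p ` snd ` G r v = snd ` G r v" by (simp add: image_image)
    then show ?thesis using spread[OF that] by auto
  qed
  then have "snd ` (if t2 n \<le> r \<and> r < t3 Q n then Pair ((r - t2 n) mod Q) ` snd ` G r v else {})
      \<subseteq> enc_token ` Top"
    by simp
  then have "snd ` set (held (st (Suc r) v)) \<subseteq> enc_token ` Top"
    unfolding held_Suc[OF Suc.prems] image_Un using Suc.IH[OF Suc.prems] by (simp only: Un_least)
  ultimately show ?case by simp
qed

subsection \<open>Flooding\<close>

text \<open>The edge at the source \<open>u\<close> is peeled off: one round moves the knowledge to
  a node \<open>y\<close> within \<open>k\<close> hops of \<open>v\<close>, the remaining
  \<open>k\<close> rounds move it on.\<close>

lemma known_flood:
  assumes "v \<in> V" "u \<in> nbhd E v k"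
  shows "known_set (st r u) \<subseteq> known_set (st (r + k) v)"
  using assms(2)
proof (induction k arbitrary: r u)
  case (Suc k)
  have step: "known_set (st r u) \<subseteq> known_set (st (Suc r) y)" if "y \<in> V" "u = y \<or> (u, y) \<in> E" for y
    unfolding known_Suc[OF that(1)] using that(2) by auto
  have "u \<in> nbhd E v k \<or> (\<exists>y\<in>nbhd E v k. (y, u) \<in> E)"
    using Suc.prems by auto
  then obtain y where y: "y \<in> nbhd E v k" "u = y \<or> (u, y) \<in> E"
    using symD[OF sym_E] by blast
  then have "y \<in> V" using nbhd_subset[OF E_V assms(1)] by blast
  then have "known_set (st r u) \<subseteq> known_set (st (Suc r) y)" using step y(2) by blast
  also have "\<dots> \<subseteq> known_set (st (Suc r + k) v)" by (rule Suc.IH[OF y(1)])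
  finally show ?case by simp
qed auto

lemma known_nbhd:
  assumes "v \<in> V" "a \<in> nbhd E v k" "k \<le> r" "(a, b) \<in> E"
  shows "(a, b, w a b) \<in> known_set (st r v)"
proof -
  have "{(a, u, w a u) |u. (a, u) \<in> E} \<subseteq> Top" by (auto simp: topology_def)
  then have "finite {(a, u, w a u) |u. (a, u) \<in> E}" using finite_Top finite_subset by blast
  then have "(a, b, w a b) \<in> known_set (st 0 a)"
    using assms(4) E_V by (subst st_0) auto
  moreover have "a \<in> nbhd E v r" by (rule subsetD[OF nbhd_mono[OF assms(3)] assms(2)])
  ultimately show ?thesis using known_flood[OF assms(1), of a r 0] by auto
qed

lemma edges_known:
  assumes "v \<in> V"
  shows "edges (known_set (st r v)) \<subseteq> E"
proof -
  have "edges (known_set (st r v)) \<subseteq> edges Top"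
    using sound[OF assms, of r] unfolding edges_def by blast
  then show ?thesis by (simp only: edges_Top)
qed

text \<open>The ball around \<open>x\<close> lies in the ball of radius \<open>j + k\<close> around
  \<open>v\<close>, whose incident edges have reached \<open>v\<close> by round
  \<open>j + k\<close>.\<close>

lemma view_nbhd:
  assumes "v \<in> V" "x \<in> nbhd E v j" "j + k \<le> r"
  shows "nbhd (edges (known_set (st r v))) x k = nbhd E x k"
proof (rule nbhd_local[OF edges_known[OF assms(1)]])
  fix a b assume "a \<in> nbhd E x k" and ab: "(a, b) \<in> E"
  then have "a \<in> nbhd E v (j + k)" using assms(2) nbhd_trans by metis
  from known_nbhd[OF assms(1) this assms(3) ab]
  show "(a, b) \<in> edges (known_set (st r v))" by (auto simp: edges_def)
qed

text \<open>Ownership of the edges at \<open>v\<close> depends only on the degrees of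
  \<open>v\<close> and its neighbours, which one round of flooding reveals.\<close>

lemma view_tokens:
  assumes "v \<in> V" "1 \<le> r"
  shows "my_tokens (st r v) = tokens Top v"
proof -
  let ?X = "known_set (st r v)"
  have img: "edges ?X `` {a} = E `` {a}" if "a \<in> nbhd E v 1" for a
    using known_nbhd[OF assms(1) that assms(2)] edges_known[OF assms(1), of r] by (auto simp: edges_def)
  have mem: "(v, b, c) \<in> ?X \<longleftrightarrow> (v, b, c) \<in> Top" for b c
    using known_nbhd[OF assms(1) nbhd_self[of v E 1] assms(2)] sound[OF assms(1), of r]
    by (auto simp: topology_def)
  have nb: "b \<in> nbhd E v 1" if "(v, b, c) \<in> Top" for b c
    using that by (auto simp: topology_def)
  have "owned ?X v = owned Top v"
  proof -
    have "(v, b, c) \<in> ?X \<and> card (edges ?X `` {v}) \<le> card (edges ?X `` {b}) \<longleftrightarrow>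
        (v, b, c) \<in> Top \<and> card (E `` {v}) \<le> card (E `` {b})" for b c
      using mem[of b c] img[OF nb, of b c] img[OF nbhd_self] by metis
    then show ?thesis unfolding owned_def edges_Top by blast
  qed
  then show ?thesis using assms by (simp add: my_tokens_def tokens_def)
qed

subsection \<open>Election of the rulers\<close>

definition fresh :: "nat list \<Rightarrow> nat \<Rightarrow> nat" where
  "fresh rs v = (if covered E s rs v then n + 1 else v)"

text \<open>The centralised counterpart of one election block.\<close>

definition elect :: "nat list \<Rightarrow> nat list" where
  "elect rs = (let m = Min (fresh rs ` V) in if m \<le> n then rs @ [m] else rs)"

lemma view_covered:
  assumes "v \<in> V" "2 * s \<le> r"
  shows "covered (edges (known_set (st r v))) s rs v = covered E s rs v"
  unfolding covered_def using view_nbhd[OF assms(1) nbhd_self, of 0 "2 * s" r] assms(2) by simp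

lemma rulers_before: "v \<in> V \<Longrightarrow> r \<le> t0 n \<Longrightarrow> rulers (st r v) = []"
  by (induction r) (auto simp: st_0 rulers_Suc)

lemma n_less_pow: "n + 1 < n ^ C"
proof -
  have "2 * n \<le> n * n" using n2 by (rule mult_le_mono1)
  then have "n + 1 < n * n" using n2 by linarith
  also have "\<dots> = n ^ 2" by (simp add: power2_eq_square)
  also have "\<dots> \<le> n ^ C" using C3 n2 by (intro power_increasing) auto
  finally show ?thesis .
qed

lemma election_step:
  assumes t: "t0 n \<le> t" "t < t1 n" and j: "j = (t - t0 n) mod L"
    and y: "\<And>v. v \<in> V \<Longrightarrow> cur_agg n (st t v) = y v \<and> y v \<le> n + 1"
    and v: "v \<in> V"
  shows "agg (st (Suc t) v) = Min (insert (y v) {y u | u. u \<in> V \<and> shift n (2 ^ j) u = v})"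
proof -
  have send: "send Q n (st t u) = [(shift n (2 ^ j) u, y u)]" if "u \<in> V" for u
    using that y[OF that] t by (simp add: send_phase send_rulers_def j)
  have "G t v = {(u, y u) | u. u \<in> V \<and> shift n (2 ^ j) u = v}"
  proof (intro set_eqI iffI)
    fix g assume "g \<in> G t v"
    then show "g \<in> {(u, y u) | u. u \<in> V \<and> shift n (2 ^ j) u = v}"
      using G_sent[of "fst g" "snd g" t v] send by (cases g) auto
  next
    fix g assume "g \<in> {(u, y u) | u. u \<in> V \<and> shift n (2 ^ j) u = v}"
    then obtain u where u: "g = (u, y u)" "u \<in> V" "shift n (2 ^ j) u = v" by auto
    have "(u, y u) \<in> G t v"
    proof (rule G_all)
      fix a a' b m m'
      assume "a \<in> V" "a' \<in> V" "(b, m) \<in> set (send Q n (st t a))" "(b, m') \<in> set (send Q n (st t a'))"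
      then show "a = a'" using send shift_inj_V[of a a' "2 ^ j"] by auto
    next
      show "y u < n ^ C" using y[OF u(2)] n_less_pow by linarith
    qed (use u send in auto)
    then show "g \<in> G t v" using u by simp
  qed
  then have "snd ` G t v = {y u | u. u \<in> V \<and> shift n (2 ^ j) u = v}" by force
  then show ?thesis using y[OF v] v by (simp add: agg_Suc)
qed

text \<open>Loop invariant of a block: every value is some node's candidate, and after
  \<open>j\<close> rounds the candidate of \<open>u\<close> has influenced all nodes at cyclic
  distance below \<open>2 ^ j\<close>. The case \<open>j = 0\<close> in \<open>y\<close> reflects
  the restart of the minimum.\<close>

lemma election_round:
  assumes i: "i < s" and rs: "\<And>v. v \<in> V \<Longrightarrow> rulers (st (t0 n + i * L) v) = rs"
    and j: "j \<le> L"
  defines "y \<equiv> \<lambda>j v. if j = 0 then fresh rs v else agg (st (t0 n + i * L + j) v)"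
  shows "(\<forall>v\<in>V. y j v \<in> fresh rs ` V) \<and> (\<forall>u\<in>V. \<forall>k<2 ^ j. y j (shift n k u) \<le> fresh rs u) \<and>
    (j < L \<longrightarrow> (\<forall>v\<in>V. rulers (st (t0 n + i * L + j) v) = rs))"
  using j
proof (induction j)
  case 0
  show ?case using rs shift_0_V by (auto simp: y_def)
next
  case (Suc j)
  let ?t = "t0 n + i * L + j"
  have j: "j < L" using Suc.prems by simp
  note IH = Suc.IH[OF less_imp_le[OF j]]
  have "i * L + j < Suc i * L" using j by simp
  also have "\<dots> \<le> s * L" using i by (intro mult_le_mono1) simp
  finally have t: "t0 n \<le> ?t" "?t < t1 n" by (auto simp: t1_def)
  have jm: "(?t - t0 n) mod L = j" using j by simp
  have fresh_le: "fresh rs u \<le> n + 1" if "u \<in> V" for u using V_le[OF that] by (auto simp: fresh_def)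
  have cur: "cur_agg n (st ?t v) = y j v \<and> y j v \<le> n + 1" if "v \<in> V" for v
  proof -
    have "candidate n (st ?t v) = fresh rs v"
      using that j IH view_covered[OF that, of ?t rs] by (simp add: candidate_def fresh_def t0_def)
    then have "cur_agg n (st ?t v) = y j v"
      using that j by (cases "j = 0") (simp_all add: cur_agg_def y_def)
    moreover have "y j v \<in> fresh rs ` V" using IH that by blast
    ultimately show ?thesis using fresh_le by auto
  qed
  have step: "y (Suc j) v = Min (insert (y j v) {y j u | u. u \<in> V \<and> shift n (2 ^ j) u = v})" if "v \<in> V" for v
    using election_step[OF t jm[symmetric] cur that] by (simp add: y_def)
  have fin: "finite (insert (y j v) {y j u | u. u \<in> V \<and> shift n (2 ^ j) u = v})" for v by simp
  have "y (Suc j) v \<in> fresh rs ` V" if "v \<in> V" for v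
  proof -
    have "y (Suc j) v \<in> insert (y j v) {y j u | u. u \<in> V \<and> shift n (2 ^ j) u = v}"
      unfolding step[OF that] by (rule Min_in[OF fin]) simp
    then show ?thesis using IH that by auto
  qed
  moreover have "y (Suc j) (shift n k u) \<le> fresh rs u" if u: "u \<in> V" and k: "k < 2 ^ Suc j" for u k
  proof -
    let ?v = "shift n k u"
    have v: "?v \<in> V" using shift_V n2 by simp
    have "\<exists>z \<in> insert (y j ?v) {y j u | u. u \<in> V \<and> shift n (2 ^ j) u = ?v}. z \<le> fresh rs u"
    \<comment> \<open>Beyond \<open>2 ^ j\<close> the bound arrives in this round from the node
      \<open>2 ^ j\<close> positions back.\<close>
    proof (cases "k < 2 ^ j")
      case True
      then show ?thesis using IH u by auto
    next
      case False
      let ?z = "shift n (k - 2 ^ j) u"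
      have "shift n (2 ^ j) ?z = ?v" using False by (simp add: shift_shift)
      moreover have "?z \<in> V" using shift_V n2 by simp
      moreover have "y j ?z \<le> fresh rs u" using IH u k False by auto
      ultimately show ?thesis by blast
    qed
    then obtain z where "z \<in> insert (y j ?v) {y j u | u. u \<in> V \<and> shift n (2 ^ j) u = ?v}" "z \<le> fresh rs u"
      by blast
    then show ?thesis unfolding step[OF v] using Min_le[OF fin] by (meson order_trans)
  qed
  moreover have "rulers (st (t0 n + i * L + Suc j) v) = rs" if "v \<in> V" "Suc j < L" for v
  proof -
    have "Suc (?t - t0 n) = Suc j + i * L" by simp
    then have "Suc (?t - t0 n) mod L = Suc j" using that(2) by (simp only: mod_mult_self1 mod_less)
    then show ?thesis using that(1) IH j rulers_Suc[OF that(1), of ?t] by simp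
  qed
  ultimately show ?case by blast
qed

text \<open>Since \<open>n <= 2 ^ L\<close>, the invariant at \<open>j = L\<close> covers all
  shifts, so every node has the global minimum and appends the same ruler.\<close>

lemma election_result:
  assumes i: "i < s" and rs: "\<And>v. v \<in> V \<Longrightarrow> rulers (st (t0 n + i * L) v) = rs" and v: "v \<in> V"
  shows "rulers (st (t0 n + Suc i * L) v) = elect rs"
proof -
  note R = election_round[OF i rs]
  define t where "t = t0 n + i * L + (L - 1)"
  have St: "Suc t = t0 n + i * L + L" using lg_pos by (simp add: t_def)
  have "agg (st (Suc t) v) = Min (fresh rs ` V)"
  proof (rule Min_eqI[symmetric])
    show "agg (st (Suc t) v) \<in> fresh rs ` V"
      using R[of L] v lg_pos by (simp add: St)
    fix z assume "z \<in> fresh rs ` V"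
    then obtain u where u: "u \<in> V" "z = fresh rs u" by auto
    obtain k where "k < n" "shift n k u = v" using shift_reach_V[OF u(1) v] .
    then show "agg (st (Suc t) v) \<le> z"
      using R[of L] u n_le_lg lg_pos by (auto simp: St)
  qed simp
  moreover have "rulers (st t v) = rs"
    using R[of "L - 1"] lg_pos v by (simp add: t_def)
  moreover have "t0 n \<le> t" by (simp add: t_def)
  moreover have "t < t1 n"
  proof -
    have "Suc i * L \<le> s * L" using i by (intro mult_le_mono1) simp
    then show ?thesis using St by (simp add: t1_def)
  qed
  moreover have "Suc (t - t0 n) mod L = 0" using lg_pos by (simp add: t_def)
  ultimately have "rulers (st (Suc t) v) = elect rs"
    using v by (simp add: rulers_Suc elect_def Let_def)
  then show ?thesis by (simp add: St add.commute add.left_commute)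
qed

definition final_rulers :: "nat list" where
  "final_rulers = (elect ^^ s) []"

lemma rulers_after:
  assumes "v \<in> V" "t1 n \<le> r"
  shows "rulers (st r v) = final_rulers"
  using assms(2)
proof (induction r rule: dec_induct)
  case base
  have "i \<le> s \<Longrightarrow> \<forall>v\<in>V. rulers (st (t0 n + i * L) v) = (elect ^^ i) []" for i
  proof (induction i)
    case 0
    then show ?case by (simp add: rulers_before)
  next
    case (Suc i)
    then show ?case using election_result[of i "(elect ^^ i) []"] by simp
  qed
  then show ?case using assms(1) by (simp add: final_rulers_def t1_def)
next
  case (step r)
  then show ?case using assms(1) by (simp add: rulers_Suc)
qed

definition spaced :: "nat set \<Rightarrow> bool" where
  "spaced X \<longleftrightarrow> X \<subseteq> V \<and> (\<forall>a\<in>X. \<forall>b\<in>X. a \<noteq> b \<longrightarrow> b \<notin> nbhd E a (2 * s))"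

text \<open>A minimum of at most \<open>n\<close> is an uncovered node, hence far from all earlier
  rulers; otherwise everything is covered.\<close>

lemma elect_props:
  assumes "spaced (set rs)" "distinct rs"
  shows "spaced (set (elect rs)) \<and> distinct (elect rs) \<and>
    (if \<forall>v\<in>V. covered E s rs v then elect rs = rs else length (elect rs) = Suc (length rs))"
proof (cases "Min (fresh rs ` V) \<le> n")
  case True
  define m where "m = Min (fresh rs ` V)"
  have "m \<in> fresh rs ` V" unfolding m_def using V_nonempty by (intro Min_in) auto
  then obtain v where "v \<in> V" "m = fresh rs v" by blast
  moreover from this have "m = v" "\<not> covered E s rs v"
    using True unfolding m_def[symmetric] by (auto simp: fresh_def split: if_splits)
  ultimately have m: "m \<in> V" "\<not> covered E s rs m" by auto
  have far: "r \<notin> nbhd E m (2 * s)" if "r \<in> set rs" for r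
    using m that by (auto simp: covered_def)
  have far': "m \<notin> nbhd E r (2 * s)" if "r \<in> set rs" for r
    using far[OF that] nbhd_sym[OF sym_E] by blast
  have "m \<notin> set rs" using far[of m] nbhd_self[of m E] by blast
  moreover have "spaced (insert m (set rs))"
    using assms(1) m(1) far far' unfolding spaced_def by auto
  ultimately show ?thesis using True assms m by (auto simp: elect_def m_def)
next
  case False
  have "covered E s rs v" if "v \<in> V" for v
  proof (rule ccontr)
    assume "\<not> covered E s rs v"
    then have "fresh rs v = v" by (simp add: fresh_def)
    then have "v \<in> fresh rs ` V" using that by force
    then have "Min (fresh rs ` V) \<le> v" by simp
    with False V_le[OF that] show False by simp
  qed
  then show ?thesis using False assms by (simp add: elect_def)
qed

lemma spaced_disjoint:
  assumes "spaced X" "a \<in> X" "b \<in> X" "x \<in> nbhd E a s" "x \<in> nbhd E b s"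
  shows "a = b"
proof (rule ccontr)
  assume "a \<noteq> b"
  have "b \<in> nbhd E x s" using nbhd_sym[OF sym_E assms(5)] .
  from nbhd_trans[OF this assms(4)] have "b \<in> nbhd E a (2 * s)" by (simp add: mult_2)
  with assms \<open>a \<noteq> b\<close> show False by (auto simp: spaced_def)
qed

lemma card_nbhd_or_all:
  assumes "r \<in> V"
  shows "k < card (nbhd E r k) \<or> V \<subseteq> nbhd E r k"
proof -
  have "(r, y) \<in> E\<^sup>*" if "y \<in> V" for y
    using that assms conn by (auto simp: graph_connected_def V_def)
  then show ?thesis using card_nbhd_gt[OF E_V finite_V assms] by blast
qed

text \<open>Packing: with more than \<open>s\<close> centres, no ball of radius \<open>s\<close>
  contains a second centre, so each has at least \<open>s + 1\<close> nodes. Disjointness would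
  force \<open>(s + 1) * (s + 1) <= n <= s * s\<close>.\<close>

lemma spaced_card:
  assumes "spaced X"
  shows "card X \<le> s"
proof (rule ccontr)
  assume big: "\<not> card X \<le> s"
  have fX: "finite X" using assms finite_subset[OF _ finite_V] by (simp add: spaced_def)
  have XV: "X \<subseteq> V" using assms by (auto simp: spaced_def)
  have "s + 1 \<le> card (nbhd E a s)" if a: "a \<in> X" for a
  proof -
    have "\<not> X \<subseteq> {a}" using big sq_pos card_mono[of "{a}" X] by auto
    then obtain b where b: "b \<in> X" "b \<noteq> a" by auto
    have "b \<notin> nbhd E a s" using spaced_disjoint[OF assms a b(1) _ nbhd_self] b by auto
    moreover have "a \<in> V" "b \<in> V" using a b XV by auto
    ultimately have "s < card (nbhd E a s)" using card_nbhd_or_all[of a s] by blast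
    then show ?thesis by simp
  qed
  then have "(\<Sum>a\<in>X. s + 1) \<le> (\<Sum>a\<in>X. card (nbhd E a s))" by (intro sum_mono)
  also have "\<dots> = card (\<Union>a\<in>X. nbhd E a s)"
  proof (rule card_UN_disjoint[symmetric])
    show "\<forall>a\<in>X. finite (nbhd E a s)"
    proof
      fix a assume "a \<in> X"
      then show "finite (nbhd E a s)"
        using XV by (intro finite_subset[OF nbhd_subset[OF E_V] finite_V]) auto
    qed
  qed (use fX spaced_disjoint[OF assms] in blast)+
  also have "\<dots> \<le> card V" using nbhd_subset[OF E_V] XV by (intro card_mono) auto
  also have "\<dots> \<le> s * s" using n_le_sq by simp
  finally have "card X * (s + 1) \<le> s * s" by simp
  moreover have "(s + 1) * (s + 1) \<le> card X * (s + 1)" using big by (intro mult_le_mono1) simp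
  ultimately show False by simp
qed

text \<open>Until everything is covered, each block adds a ruler. A node left uncovered after
  \<open>s\<close> blocks would allow one more election and thus \<open>s + 1\<close> spaced rulers,
  against the packing bound.\<close>

lemma final_rulers_props:
  "spaced (set final_rulers)" "distinct final_rulers" "length final_rulers \<le> s"
  "v \<in> V \<Longrightarrow> covered E s final_rulers v"
proof -
  have I: "spaced (set ((elect ^^ i) [])) \<and> distinct ((elect ^^ i) []) \<and>
    ((\<forall>v\<in>V. covered E s ((elect ^^ i) []) v) \<or> length ((elect ^^ i) []) = i)" for i
  proof (induction i)
    case (Suc i)
    let ?rs = "(elect ^^ i) []"
    have P: "spaced (set ?rs)" "distinct ?rs" using Suc.IH by auto
    consider "elect ?rs = ?rs" "\<forall>v\<in>V. covered E s ?rs v"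
      | "\<not> (\<forall>v\<in>V. covered E s ?rs v)" "length (elect ?rs) = Suc (length ?rs)"
      using elect_props[OF P] by presburger
    then show ?case using elect_props[OF P] Suc.IH by cases auto
  qed (simp add: spaced_def)
  from I[of s] show sp: "spaced (set final_rulers)" and di: "distinct final_rulers"
    by (auto simp: final_rulers_def)
  show "length final_rulers \<le> s" using spaced_card[OF sp] distinct_card[OF di] by simp
  show "covered E s final_rulers v" if v: "v \<in> V"
  proof (rule ccontr)
    assume nc: "\<not> covered E s final_rulers v"
    then have "length final_rulers = s" using I[of s] v by (auto simp: final_rulers_def)
    moreover have "\<not> (\<forall>v\<in>V. covered E s final_rulers v)" using nc v by blast
    ultimately have "length (elect final_rulers) = Suc s"
      using elect_props[OF sp di] by simp
    moreover have "spaced (set (elect final_rulers))" "distinct (elect final_rulers)"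
      using elect_props[OF sp di] by auto
    ultimately show False using spaced_card distinct_card by (metis not_less_eq_eq order_refl)
  qed
qed

subsection \<open>Numbering the tokens\<close>

definition cnt :: "nat \<Rightarrow> nat" where "cnt v = length (tokens Top v)"

lemma cnt_card: "cnt v = card {b. (v, b) \<in> E \<and> card (E `` {v}) \<le> card (E `` {b})}"
proof -
  have "owned Top v = (\<lambda>b. (v, b, w v b)) ` {b. (v, b) \<in> E \<and> card (E `` {v}) \<le> card (E `` {b})}"
    unfolding owned_def edges_Top by (auto simp: topology_def)
  then have "card (owned Top v) = card {b. (v, b) \<in> E \<and> card (E `` {v}) \<le> card (E `` {b})}"
    by (simp add: card_image inj_on_def)
  then show ?thesis
    unfolding cnt_def using tokens_props[OF finite_Top, of v] distinct_card by metis
qed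

lemma finite_Image_E: "finite (E `` {v})"
  by (rule finite_subset[OF _ finite_V]) (use E_V in auto)

lemma cnt_le_deg: "cnt v \<le> card (E `` {v})"
  unfolding cnt_card by (rule card_mono[OF finite_Image_E]) auto

lemma sum_deg_le: "finite B \<Longrightarrow> (\<Sum>b\<in>B. card (E `` {b})) \<le> card E"
proof -
  assume "finite B"
  then have "(\<Sum>b\<in>B. card (E `` {b})) = card (SIGMA b:B. E `` {b})"
    using finite_Image_E by simp
  also have "\<dots> \<le> card E" by (rule card_mono[OF finite_E]) auto
  finally show ?thesis .
qed

lemma cnt_square: "cnt v * cnt v \<le> card E"
proof -
  define B where "B = {b. (v, b) \<in> E \<and> card (E `` {v}) \<le> card (E `` {b})}"
  have fB: "finite B" by (rule finite_subset[OF _ finite_Image_E[of v]]) (auto simp: B_def)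
  have "cnt v * cnt v \<le> card B * card (E `` {v})"
    using cnt_le_deg by (intro mult_le_mono) (auto simp: B_def cnt_card)
  also have "\<dots> = (\<Sum>b\<in>B. card (E `` {v}))" by simp
  also have "\<dots> \<le> (\<Sum>b\<in>B. card (E `` {b}))" by (rule sum_mono) (simp add: B_def)
  also have "\<dots> \<le> card E" by (rule sum_deg_le[OF fB])
  finally show ?thesis .
qed

lemma cnt_le: "cnt v \<le> Q * s"
proof (rule ccontr)
  assume "\<not> ?thesis"
  then have "(Q * s) * (Q * s) < cnt v * cnt v" by (intro mult_strict_mono) auto
  also have "\<dots> \<le> Q * n" using cnt_square card_E order_trans by blast
  also have "\<dots> \<le> Q * (s * s)" using n_le_sq by (rule mult_le_mono2)
  also have "\<dots> \<le> Q * (Q * (s * s))" using Q_pos by (intro mult_le_mono2) simp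
  finally show False by (simp add: mult_ac)
qed

lemma sum_cnt_le: "B \<subseteq> V \<Longrightarrow> sum cnt B \<le> card E"
  using sum_mono[of B cnt "\<lambda>b. card (E `` {b})"] cnt_le_deg sum_deg_le[of B] finite_subset[OF _ finite_V]
  by (meson order_trans)

lemma card_E_less_pow: "card E < n ^ C"
proof -
  have "card E \<le> card (V \<times> V)" using E_V by (intro card_mono) auto
  also have "\<dots> < n ^ 3" using n2 by (simp add: card_cartesian_product power3_eq_cube)
  also have "\<dots> \<le> n ^ C" using C3 n2 by (intro power_increasing) auto
  finally show ?thesis .
qed

text \<open>After \<open>j\<close> rounds a node has the total over the window of the last
  \<open>2 ^ j\<close> identifiers up to its own, cut off at 1.\<close>

lemma scan:
  assumes "v \<in> V" "j \<le> L"
  shows "(if j = 0 then cnt v else psum (st (t1 n + j) v)) = sum cnt {a \<in> V. a \<le> v \<and> v < a + 2 ^ j}"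
  using assms
proof (induction j arbitrary: v)
  case 0
  then have "{a \<in> V. a \<le> v \<and> v < a + 2 ^ 0} = {v}" by auto
  then show ?case by simp
next
  case (Suc j)
  let ?t = "t1 n + j"
  define y where "y u = sum cnt {a \<in> V. a \<le> u \<and> u < a + 2 ^ j}" for u
  have t: "t1 n \<le> ?t" "?t < t2 n" using Suc.prems by (auto simp: t2_def)
  have t1: "1 \<le> t1 n" using sq_pos by (simp add: t1_def t0_def)
  have cur: "cur_psum n (st ?t u) = y u" if "u \<in> V" for u
    using Suc.IH[OF that] Suc.prems(2) that view_tokens[OF that t1]
    by (cases "j = 0") (simp_all add: cur_psum_def cnt_def y_def)
  have send: "send Q n (st ?t u) = (if u + 2 ^ j \<le> n then [(u + 2 ^ j, y u)] else [])" if "u \<in> V" for u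
    using that t cur[OF that] by (simp add: send_phase send_psum_def Let_def)
  have G: "G ?t v = {(u, y u) | u. u \<in> V \<and> u + 2 ^ j = v}"
  proof (intro set_eqI iffI)
    fix g assume "g \<in> G ?t v"
    then show "g \<in> {(u, y u) | u. u \<in> V \<and> u + 2 ^ j = v}"
      using G_sent[of "fst g" "snd g" ?t v] send[of "fst g"] by (cases g) (auto split: if_splits)
  next
    fix g assume "g \<in> {(u, y u) | u. u \<in> V \<and> u + 2 ^ j = v}"
    then obtain u where u: "g = (u, y u)" "u \<in> V" "u + 2 ^ j = v" by auto
    have "(u, y u) \<in> G ?t v"
    proof (rule G_all)
      fix a a' b m m'
      assume "a \<in> V" "a' \<in> V" "(b, m) \<in> set (send Q n (st ?t a))" "(b, m') \<in> set (send Q n (st ?t a'))"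
      then show "a = a'" using send[of a] send[of a'] by (auto split: if_splits)
    next
      have "y u \<le> card E" unfolding y_def by (rule sum_cnt_le) auto
      then show "y u < n ^ C" using card_E_less_pow by linarith
    qed (use u send V_le[OF Suc.prems(1)] in auto)
    then show "g \<in> G ?t v" using u by simp
  qed
  have "psum (st (Suc ?t) v) = y v + \<Sum>(snd ` G ?t v)"
    using psum_Suc[OF Suc.prems(1), of ?t] t cur[OF Suc.prems(1)] by simp
  also have "\<dots> = sum cnt {a \<in> V. a \<le> v \<and> v < a + 2 ^ Suc j}"
  \<comment> \<open>Either the doubled window splits into the node's own window and the one
    received, or the window already reaches down to 1 and no message arrives.\<close>
  proof (cases "2 ^ j < v")
    case True
    then have "v - 2 ^ j \<in> V" "v - 2 ^ j + 2 ^ j = v" using Suc.prems(1) by (auto simp: V_def)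
    then have "G ?t v = {(v - 2 ^ j, y (v - 2 ^ j))}" unfolding G by auto
    then have "\<Sum>(snd ` G ?t v) = y (v - 2 ^ j)" by simp
    moreover have "{a \<in> V. a \<le> v \<and> v < a + 2 ^ Suc j} =
        {a \<in> V. a \<le> v \<and> v < a + 2 ^ j} \<union> {a \<in> V. a \<le> v - 2 ^ j \<and> v - 2 ^ j < a + 2 ^ j}"
      using True by auto
    moreover have "{a \<in> V. a \<le> v \<and> v < a + 2 ^ j} \<inter> {a \<in> V. a \<le> v - 2 ^ j \<and> v - 2 ^ j < a + 2 ^ j} = {}"
      using True by auto
    ultimately show ?thesis by (simp add: y_def sum.union_disjoint)
  next
    case False
    then have "G ?t v = {}" unfolding G using V_pos by fastforce
    moreover have "{a \<in> V. a \<le> v \<and> v < a + 2 ^ Suc j} = {a \<in> V. a \<le> v \<and> v < a + 2 ^ j}"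
      using False V_pos by fastforce
    ultimately show ?thesis by (simp add: y_def)
  qed
  finally show ?case by simp
qed

text \<open>The offset of \<open>v\<close> in the global numbering: its \<open>j\<close>-th token
  has number \<open>base v + j\<close>.\<close>

definition base :: "nat \<Rightarrow> nat" where "base v = sum cnt {a \<in> V. a < v}"

lemma base_Suc: "v \<in> V \<Longrightarrow> sum cnt {a \<in> V. a \<le> v} = base v + cnt v"
proof -
  assume "v \<in> V"
  then have "{a \<in> V. a \<le> v} = insert v {a \<in> V. a < v}" by auto
  then show ?thesis by (simp add: base_def)
qed

lemma psum_after:
  assumes "v \<in> V" "t2 n \<le> r"
  shows "psum (st r v) = base v + cnt v"
  using assms(2)
proof (induction r rule: dec_induct)
  case base
  have "v < a + 2 ^ L" if "a \<in> V" for a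
    using V_le[OF assms(1)] V_pos[OF that] n_le_lg by linarith
  then have "{a \<in> V. a \<le> v \<and> v < a + 2 ^ L} = {a \<in> V. a \<le> v}" by auto
  then show ?case using scan[OF assms(1), of L] lg_pos base_Suc[OF assms(1)] by (simp add: t2_def)
next
  case (step r)
  then show ?case using assms(1) by (simp add: psum_Suc)
qed

lemma base_mono:
  assumes "a \<in> V" "a < a'"
  shows "base a + cnt a \<le> base a'"
  unfolding base_Suc[OF assms(1), symmetric] unfolding base_def
  by (rule sum_mono2) (use assms(2) in auto)

lemma index_inj:
  assumes "a \<in> V" "a' \<in> V" "j < cnt a" "j' < cnt a'" "base a + j = base a' + j'"
  shows "a = a' \<and> j = j'"
  using base_mono[of a a'] base_mono[of a' a] assms by (cases a a' rule: linorder_cases) auto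

lemma index_less:
  assumes "a \<in> V" "j < cnt a"
  shows "base a + j < Q * n"
proof -
  have "base a + j < base a + cnt a" using assms by simp
  also have "\<dots> = sum cnt {x \<in> V. x \<le> a}" using base_Suc assms by simp
  also have "\<dots> \<le> card E" by (rule sum_cnt_le) auto
  also have "\<dots> \<le> Q * n" by (rule card_E)
  finally show ?thesis .
qed

subsection \<open>Spreading the tokens\<close>

lemma send_spread_eq:
  assumes "v \<in> V" "t2 n \<le> t" "t < t3 Q n" and j: "j = (t - t2 n) div Q"
  shows "send Q n (st t v) = (if j < cnt v \<and> (base v + j) mod Q = (t - t2 n) mod Q
     then [((base v + j) div Q + 1, enc_token (tokens Top v ! j))] else [])"
proof -
  have "1 \<le> t" using assms(2) sq_pos by (simp add: t2_def t1_def t0_def)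
  then show ?thesis
    using assms by (simp add: send_phase send_spread_def Let_def view_tokens psum_after flip: cnt_def)
qed

lemma held_sub:
  "x \<in> V \<Longrightarrow> (p, m) \<in> set (held (st t x)) \<Longrightarrow>
   \<exists>a\<in>V. \<exists>j<cnt a. m = enc_token (tokens Top a ! j) \<and> (base a + j) div Q + 1 = x \<and> (base a + j) mod Q = p"
proof (induction t)
  case (Suc t)
  show ?case
  proof (cases "(p, m) \<in> set (held (st t x))")
    case False
    then have t: "t2 n \<le> t" "t < t3 Q n" and "(p, m) \<in> Pair ((t - t2 n) mod Q) ` snd ` G t x"
      using Suc.prems held_Suc[of x t] by (auto split: if_splits)
    then obtain u where u: "(u, m) \<in> G t x" and p: "p = (t - t2 n) mod Q" by auto
    from G_sent[OF u] have "u \<in> V" "(x, m) \<in> set (send Q n (st t u))" by auto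
    with send_spread_eq[OF _ t refl, of u] p show ?thesis by (auto split: if_splits)
  qed (use Suc in auto)
qed (simp add: st_0)

text \<open>Holder and slot are quotient and remainder of the global number modulo \<open>Q\<close>,
  hence determine the token. This makes the choice in \<open>send_reply\<close> unambiguous.\<close>

lemma held_unique:
  assumes "x \<in> V" "(p, m) \<in> set (held (st t x))" "(p, m') \<in> set (held (st t x))"
  shows "m = m'"
proof -
  obtain a j where a: "a \<in> V" "j < cnt a" "m = enc_token (tokens Top a ! j)"
    "(base a + j) div Q + 1 = x" "(base a + j) mod Q = p"
    using held_sub[OF assms(1,2)] by auto
  obtain a' j' where a': "a' \<in> V" "j' < cnt a'" "m' = enc_token (tokens Top a' ! j')"
    "(base a' + j') div Q + 1 = x" "(base a' + j') mod Q = p"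
    using held_sub[OF assms(1,3)] by auto
  have "base a + j = base a' + j'"
    using a a' by (metis add_right_cancel div_mult_mod_eq)
  with a a' index_inj show ?thesis by metis
qed

lemma token_in_Top: "a \<in> V \<Longrightarrow> j < cnt a \<Longrightarrow> tokens Top a ! j \<in> Top"
  using tokens_props[OF finite_Top, of a] nth_mem[of j "tokens Top a"] by (auto simp: cnt_def owned_def)

lemma held_all:
  assumes a: "a \<in> V" "j < cnt a" and t: "t3 Q n \<le> t"
  shows "(base a + j) div Q + 1 \<in> V"
    "((base a + j) mod Q, enc_token (tokens Top a ! j)) \<in> set (held (st t ((base a + j) div Q + 1)))"
proof -
  define g where "g = base a + j"
  define x where "x = g div Q + 1"
  have "g div Q < n" using index_less[OF a] Q_pos by (simp add: g_def div_less_iff_less_mult mult.commute)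
  then have x: "x \<in> V" by (simp add: x_def V_def)
  then show "(base a + j) div Q + 1 \<in> V" by (simp add: x_def g_def)
  \<comment> \<open>The only round in which this token is sent; it falls into the phase because
    \<open>j < Q * s\<close>.\<close>
  define r where "r = t2 n + (j * Q + g mod Q)"
  have "j * Q + g mod Q < Suc j * Q" using Q_pos by simp
  also have "\<dots> \<le> Q * s * Q" using a(2) cnt_le[of a] by (intro mult_le_mono1) simp
  finally have r: "t2 n \<le> r" "r < t3 Q n" by (auto simp: r_def t3_def)
  have rd: "(r - t2 n) div Q = j" "(r - t2 n) mod Q = g mod Q" using Q_pos by (auto simp: r_def)
  have "(a, enc_token (tokens Top a ! j)) \<in> G r x"
  proof (rule G_all)
    fix u u' b m m'
    assume u: "u \<in> V" "u' \<in> V" "(b, m) \<in> set (send Q n (st r u))" "(b, m') \<in> set (send Q n (st r u'))"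
    then have "j < cnt u" "j < cnt u'" "(base u + j) div Q = (base u' + j) div Q"
      "(base u + j) mod Q = (base u' + j) mod Q"
      using send_spread_eq[OF u(1) r refl] send_spread_eq[OF u(2) r refl] by (auto simp: rd split: if_splits)
    moreover from this have "base u + j = base u' + j" by (metis div_mult_mod_eq)
    ultimately show "u = u'" using index_inj[OF u(1,2)] by blast
  next
    show "(x, enc_token (tokens Top a ! j)) \<in> set (send Q n (st r a))"
      using send_spread_eq[OF a(1) r refl] a(2) by (simp add: rd x_def g_def)
    show "enc_token (tokens Top a ! j) < n ^ C" by (rule enc_bound[OF token_in_Top[OF a]])
  qed (rule a)
  then have "(g mod Q, enc_token (tokens Top a ! j)) \<in> set (held (st (Suc r) x))"
    unfolding held_Suc[OF x] using r rd by force
  moreover have "Suc r \<le> t" using r t by simp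
  then have "set (held (st (Suc r) x)) \<subseteq> set (held (st t x))"
  proof (induction t rule: dec_induct)
    case (step k)
    then show ?case using held_Suc[OF x, of k] by auto
  qed simp
  ultimately show "((base a + j) mod Q, enc_token (tokens Top a ! j)) \<in> set (held (st t ((base a + j) div Q + 1)))"
    unfolding x_def g_def by blast
qed

subsection \<open>Pulling the tokens\<close>

abbreviation role :: "nat \<Rightarrow> nat \<Rightarrow> nat \<Rightarrow> bool" where
  "role \<equiv> is_role E s final_rulers"

lemma ruler_V: "c < length final_rulers \<Longrightarrow> final_rulers ! c \<in> V"
  using final_rulers_props(1) nth_mem[of c final_rulers] by (auto simp: spaced_def)

lemma finite_nbhd: "r \<in> V \<Longrightarrow> finite (nbhd E r k)"
  by (rule finite_subset[OF nbhd_subset[OF E_V] finite_V])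

text \<open>A role depends on balls of radius \<open>s\<close> around nodes at distance at most
  \<open>s\<close>, all visible after \<open>2 * s\<close> rounds.\<close>

lemma view_role:
  assumes "v \<in> V" "2 * s \<le> t"
  shows "is_role (edges (known_set (st t v))) s rs v = is_role E s rs v"
proof (intro ext)
  fix c i
  have "nbhd (edges (known_set (st t v))) v s = nbhd E v s"
    using view_nbhd[OF assms(1) nbhd_self, of 0 s t] assms(2) by simp
  moreover have "nbhd (edges (known_set (st t v))) x s = nbhd E x s" if "x \<in> nbhd E v s" for x
    using view_nbhd[OF assms(1) that, of s t] assms(2) by simp
  ultimately show "is_role (edges (known_set (st t v))) s rs v c i = is_role E s rs v c i"
    unfolding is_role_def by auto
qed

lemma role_nbhd: "role v c i \<Longrightarrow> v \<in> nbhd E (final_rulers ! c) s"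
  using nbhd_sym[OF sym_E] by (auto simp: is_role_def)

lemma role_inj:
  assumes "role v c i" "role v' c i"
  shows "v = v'"
proof (rule rank_inj)
  show "finite (nbhd E (final_rulers ! c) s)"
    using assms ruler_V finite_nbhd by (auto simp: is_role_def)
  show "v \<in> nbhd E (final_rulers ! c) s" "v' \<in> nbhd E (final_rulers ! c) s"
    using role_nbhd assms by auto
qed (use assms in \<open>auto simp: is_role_def\<close>)

text \<open>The balls of distinct rulers are disjoint, so nobody has to fetch for two
  rulers.\<close>

lemma role_fun:
  assumes "role v c i" "role v c' i'"
  shows "c = c' \<and> i = i'"
proof -
  have "final_rulers ! c = final_rulers ! c'"
    using assms role_nbhd[OF assms(1)] role_nbhd[OF assms(2)] spaced_disjoint[OF final_rulers_props(1)]
    by (simp add: is_role_def)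
  then have "c = c'"
    using final_rulers_props(2) assms by (simp add: is_role_def nth_eq_iff_index_eq)
  with assms show ?thesis by (simp add: is_role_def)
qed

lemma role_less: "role v c i \<Longrightarrow> c < s \<and> i < s"
  using final_rulers_props(3) by (simp add: is_role_def)

lemma t3_ge: "t1 n \<le> t3 Q n" "2 * s \<le> t3 Q n"
  by (auto simp: t3_def t2_def t1_def t0_def)

lemma ask_iff:
  assumes "v \<in> V" "a < s * Q"
  shows "(x, m) \<in> set (send Q n (st (t3 Q n + 2 * a) v)) \<longleftrightarrow>
    m = 0 \<and> (\<exists>c i. role v c i \<and> x = i * s + (c + a div Q) mod s + 1)"
proof -
  let ?t = "t3 Q n + 2 * a"
  have t: "t3 Q n \<le> ?t" "?t < t4 Q n" "even (?t - t3 Q n)" using assms(2) by (auto simp: t4_def)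
  have P: "is_role (edges (known_set (st ?t v))) s (rulers (st ?t v)) v = role v"
    using view_role[OF assms(1), of ?t] t3_ge rulers_after[OF assms(1), of ?t] by simp
  have S: "send Q n (st ?t v) = (if \<exists>c i. role v c i then
      (let (c, i) = (SOME (c, i). role v c i) in [(i * s + (c + a div Q) mod s + 1, 0)]) else [])"
    unfolding send_phase(4)[OF assms(1) t] send_ask_def Let_def using assms P by auto
  show ?thesis
  proof (cases "\<exists>c i. role v c i")
    case True
    then obtain c i where ci: "role v c i" by auto
    then have "(SOME (c, i). role v c i) = (c, i)"
      using role_fun by (intro some_equality) auto
    then have S': "send Q n (st ?t v) = [(i * s + (c + a div Q) mod s + 1, 0)]"
      using S True by simp
    have "role v c' i' \<longleftrightarrow> c' = c \<and> i' = i" for c' i'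
      using role_fun[OF ci] ci by blast
    then show ?thesis using S' by auto
  qed (use S in auto)
qed

lemma ask_inj:
  assumes "v \<in> V" "v' \<in> V" "a < s * Q"
    "(x, m) \<in> set (send Q n (st (t3 Q n + 2 * a) v))" "(x, m') \<in> set (send Q n (st (t3 Q n + 2 * a) v'))"
  shows "v = v'"
proof -
  obtain c i where 1: "role v c i" "x = i * s + (c + a div Q) mod s + 1"
    using assms ask_iff by blast
  obtain c' i' where 2: "role v' c' i'" "x = i' * s + (c' + a div Q) mod s + 1"
    using assms ask_iff by blast
  have eq: "i * s + (c + a div Q) mod s = i' * s + (c' + a div Q) mod s" using 1 2 by simp
  \<comment> \<open>Division by \<open>s\<close> recovers the block from the address; within the
    block, the offset is a cyclic shift of \<open>c\<close> modulo \<open>s\<close>.\<close>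
  have "i = i'" using arg_cong[OF eq, of "\<lambda>z. z div s"] sq_pos by simp
  moreover from this eq have "(c + a div Q) mod s = (c' + a div Q) mod s" by simp
  then have "c = c'"
    using shift_inj[of "c + 1" s "c' + 1" "a div Q"] role_less[OF 1(1)] role_less[OF 2(1)]
    by (simp add: shift_def)
  ultimately show ?thesis using role_inj 1 2 by blast
qed

lemma asker_sent:
  assumes "x \<in> V" "asker (st (Suc t) x) = y" "y \<noteq> 0"
  obtains m where "(y, m) \<in> G t x"
proof -
  have ne: "G t x \<noteq> {}" and y: "y = fst (SOME g. g \<in> G t x)"
    using assms asker_Suc[OF assms(1), of t] by (auto split: if_splits)
  have "(SOME g. g \<in> G t x) \<in> G t x" using ne by (rule some_in_eq[THEN iffD2])
  with y that show ?thesis by (metis prod.collapse)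
qed

text \<open>One exchange of request and reply. By \<open>ask_inj\<close> the holder \<open>x\<close>
  hears from \<open>y\<close> only, and its slot contains a single token.\<close>

lemma pull:
  assumes y: "y \<in> V" "role y c i" and a: "a < s * Q"
    and x: "x \<in> V" "x = i * s + (c + a div Q) mod s + 1"
    and m: "(a mod Q, enc_token z) \<in> set (held (st (t3 Q n + 2 * a + 1) x))"
  shows "z \<in> known_set (st (t3 Q n + 2 * a + 2) y)"
proof -
  let ?t = "t3 Q n + 2 * a"
  have ask: "(x, 0) \<in> set (send Q n (st ?t y))" using ask_iff y a x by blast
  have "(y, 0) \<in> G ?t x"
  proof (rule G_all)
    show "0 < n ^ C" using n2 by simp
  qed (use ask_inj[OF _ _ a] ask y in auto)
  moreover have "g = (y, 0)" if "g \<in> G ?t x" for g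
  proof -
    have "fst g \<in> V" "(x, snd g) \<in> set (send Q n (st ?t (fst g)))" using G_sent[of "fst g" "snd g" ?t x] that by auto
    with ask ask_inj[OF _ y(1) a] ask_iff[OF _ a] show ?thesis by (metis prod.collapse)
  qed
  ultimately have "G ?t x = {(y, 0)}" by blast
  then have asker: "asker (st (Suc ?t) x) = y" by (simp add: asker_Suc[OF x(1)])
  have t: "t3 Q n \<le> Suc ?t" "Suc ?t < t4 Q n" "odd (Suc ?t - t3 Q n)"
    using a by (auto simp: t4_def Suc_diff_le)
  have half: "(Suc ?t - t3 Q n) div 2 = a" by (simp add: Suc_diff_le)
  note reply = send_phase(5)[OF _ t]
  have "(SOME m. (a mod Q, m) \<in> set (held (st (Suc ?t) x))) = enc_token z"
    using m held_unique[OF x(1)] by (intro some_equality) auto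
  then have sent: "(y, enc_token z) \<in> set (send Q n (st (Suc ?t) x))"
    unfolding reply[OF x(1)] send_reply_def Let_def using m asker V_pos[OF y(1)] half x(1) by auto
  have "(x, enc_token z) \<in> G (Suc ?t) y"
  proof (rule G_all)
    \<comment> \<open>Two nodes replying to \<open>b\<close> would both have been asked by
      \<open>b\<close>, which sent a single request.\<close>
    fix u u' b k k'
    assume u: "u \<in> V" "u' \<in> V" "(b, k) \<in> set (send Q n (st (Suc ?t) u))" "(b, k') \<in> set (send Q n (st (Suc ?t) u'))"
    then have b: "asker (st (Suc ?t) u) = b" "asker (st (Suc ?t) u') = b" "b \<noteq> 0"
      unfolding reply[OF u(1)] reply[OF u(2)] by (auto simp: send_reply_def Let_def split: if_splits)
    obtain l where "(b, l) \<in> G ?t u" using asker_sent[OF u(1) b(1,3)] .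
    moreover obtain l' where "(b, l') \<in> G ?t u'" using asker_sent[OF u(2) b(2,3)] .
    ultimately have "(u, l) \<in> set (send Q n (st ?t b))" "(u', l') \<in> set (send Q n (st ?t b))"
      using G_sent by blast+
    then show "u = u'" using send_unique by blast
  next
    have "enc_token z \<in> enc_token ` Top" using sound[OF x(1), of "?t + 1"] m by force
    then show "enc_token z < n ^ C" using enc_bound by auto
  qed (use x sent in auto)
  then have "dec_token (enc_token z) \<in> dec_token ` snd ` G (Suc ?t) y" by force
  then show ?thesis using t known_Suc[OF y(1), of "Suc ?t"] by simp
qed

subsection \<open>Completeness\<close>

lemma known_mono: "v \<in> V \<Longrightarrow> r \<le> r' \<Longrightarrow> known_set (st r v) \<subseteq> known_set (st r' v)"
  using known_flood[OF _ nbhd_self, of v r "r' - r"] by simp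

lemma role_knows:
  assumes y: "y \<in> V" "role y c i" and a: "a \<in> V" "j < cnt a"
    and i: "(base a + j) div Q div s = i"
  shows "tokens Top a ! j \<in> known_set (st (t4 Q n) y)"
proof -
  define g where "g = base a + j"
  define x where "x = g div Q + 1"
  \<comment> \<open>The step of the cyclic walk from offset \<open>c\<close> at which the holder of
    token \<open>g\<close> is visited; adding \<open>s\<close> first keeps the subtraction from
    truncating. The request number \<open>b\<close> below combines this step with the slot of the
    token.\<close>
  define d where "d = (g div Q mod s + s - c) mod s"
  have c: "c < s" using role_less[OF y(2)] by simp
  have "d < s" using sq_pos by (simp add: d_def)
  have "(c + d) mod s = (c + (g div Q mod s + s - c)) mod s" by (simp add: d_def mod_add_right_eq)
  also have "\<dots> = g div Q mod s" using c by simp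
  finally have cd: "(c + d) mod s = g div Q mod s" .
  define b where "b = d * Q + g mod Q"
  have "b < Suc d * Q" using Q_pos by (simp add: b_def)
  also have "\<dots> \<le> s * Q" using \<open>d < s\<close> by (intro mult_le_mono1) simp
  finally have b: "b < s * Q" .
  have bd: "b div Q = d" "b mod Q = g mod Q" using Q_pos by (auto simp: b_def)
  have "g div Q = i * s + g div Q mod s"
    using i div_mult_mod_eq[of "g div Q" s] by (simp add: g_def)
  then have "x = i * s + (c + b div Q) mod s + 1"
    by (simp only: x_def bd cd)
  moreover have "x \<in> V" using held_all(1)[OF a order_refl] by (simp add: x_def g_def)
  moreover have "(b mod Q, enc_token (tokens Top a ! j)) \<in> set (held (st (t3 Q n + 2 * b + 1) x))"
    using held_all(2)[OF a, of "t3 Q n + 2 * b + 1"] by (simp add: bd x_def g_def)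
  ultimately have "tokens Top a ! j \<in> known_set (st (t3 Q n + 2 * b + 2) y)"
    using pull[OF y b] by blast
  moreover have "t3 Q n + 2 * b + 2 \<le> t4 Q n" using b by (simp add: t4_def)
  ultimately show ?thesis using known_mono[OF y(1)] by blast
qed

text \<open>A ruler within \<open>2 * s\<close> of \<open>v\<close> has all its fetchers within
  \<open>3 * s\<close>. If its ball has more than \<open>s\<close> nodes, every fetcher number is
  occupied; otherwise the ball is the whole graph and flooding from \<open>a\<close>
  suffices.\<close>

lemma complete:
  assumes v: "v \<in> V" and e: "(a, b) \<in> E" and deg: "card (E `` {a}) \<le> card (E `` {b})"
  shows "(a, b, w a b) \<in> known_set (st (t4 Q n + 3 * s) v)"
proof -
  have aV: "a \<in> V" using e E_V by auto
  obtain c where c: "c < length final_rulers" "final_rulers ! c \<in> nbhd E v (2 * s)"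
    using final_rulers_props(4)[OF v] by (auto simp: covered_def in_set_conv_nth)
  define r where "r = final_rulers ! c"
  have rV: "r \<in> V" using ruler_V c by (simp add: r_def)
  have near: "y \<in> nbhd E v (3 * s)" if "y \<in> nbhd E r s" for y
    using nbhd_trans[OF that, of v "2 * s"] c by (simp add: r_def)
  from card_nbhd_or_all[OF rV, of s] show ?thesis
  proof
    assume big: "s < card (nbhd E r s)"
    have "(a, b, w a b) \<in> owned Top a"
      unfolding owned_def edges_Top using e deg by (auto simp: topology_def)
    then obtain j where j: "j < cnt a" "tokens Top a ! j = (a, b, w a b)"
      using tokens_props(2)[OF finite_Top, of a] by (metis cnt_def in_set_conv_nth)
    define i where "i = (base a + j) div Q div s"
    have "(base a + j) div Q < n"
      using index_less[OF aV j(1)] Q_pos by (simp add: div_less_iff_less_mult mult.commute)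
    then have i: "i < s"
      using n_le_sq sq_pos by (simp add: i_def div_less_iff_less_mult)
    with big have "i < card (nbhd E r s)" by simp
    then obtain y where y: "y \<in> nbhd E r s" "card {x \<in> nbhd E r s. x < y} = i"
      using rank_surj[OF finite_nbhd[OF rV]] by blast
    have role: "role y c i"
      using c(1) i y nbhd_sym[OF sym_E y(1)] by (simp add: is_role_def r_def)
    have yV: "y \<in> V" using y nbhd_subset[OF E_V rV] by auto
    have "(a, b, w a b) \<in> known_set (st (t4 Q n) y)"
      using role_knows[OF yV role aV j(1) i_def[symmetric]] unfolding j(2) .
    then show ?thesis using known_flood[OF v near[OF y(1)]] by blast
  next
    assume "V \<subseteq> nbhd E r s"
    then have "a \<in> nbhd E v (3 * s)" using near aV by blast
    from known_nbhd[OF v this _ e] show ?thesis by simp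
  qed
qed

lemma out_eq_topology:
  assumes v: "v \<in> V"
  shows "out (topology_alg Qf C) n (S (t4 Q n + 3 * s) v) = Top"
proof -
  define X where "X = known_set (st (t4 Q n + 3 * s) v)"
  have out: "out (topology_alg Qf C) n (S (t4 Q n + 3 * s) v) = X \<union> {(b, a, c). (a, b, c) \<in> X}"
    by (simp add: topology_alg_def st_def X_def Let_def)
  have sub: "X \<subseteq> Top" using sound[OF v] by (simp add: X_def)
  have flip: "(b, a, c) \<in> Top" if "(a, b, c) \<in> Top" for a b c
  proof -
    have e: "(a, b) \<in> E" "c = w a b" using that by (auto simp: topology_def)
    then show ?thesis using symD[OF sym_E e(1)] w_sym[OF e(1)] by (simp add: topology_def)
  qed
  have "(a, b, w a b) \<in> X \<or> (b, a, w a b) \<in> X" if e: "(a, b) \<in> E" for a b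
  proof (cases "card (E `` {a}) \<le> card (E `` {b})")
    case True
    then show ?thesis using complete[OF v e] by (simp add: X_def)
  next
    case False
    then show ?thesis using complete[OF v symD[OF sym_E e]] w_sym[OF e] by (simp add: X_def)
  qed
  then have "Top \<subseteq> X \<union> {(b, a, c). (a, b, c) \<in> X}" by (auto simp: topology_def)
  moreover have "X \<union> {(b, a, c). (a, b, c) \<in> X} \<subseteq> Top" using sub flip by auto
  ultimately show ?thesis unfolding out by (rule equalityI[rotated])
qed

end

section \<open>Message size and running time\<close>

lemma prod_encode_less: "prod_encode (a, b) < (a + b + 1) ^ 2"
proof -
  have "triangle (a + b) \<le> (a + b) * Suc (a + b)" by (simp add: triangle_def)
  then have "prod_encode (a, b) \<le> (a + b) * Suc (a + b) + a" by (simp add: prod_encode_def)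
  also have "\<dots> < (a + b + 1) ^ 2" by (simp add: power2_eq_square algebra_simps)
  finally show ?thesis .
qed

lemma prod_encode_less_pow:
  fixes n :: nat
  assumes "2 \<le> n" "a \<le> n ^ k" "b \<le> n ^ k"
  shows "prod_encode (a, b) < n ^ (2 * k + 4)"
proof -
  have p: "1 \<le> n ^ k" using assms(1) by simp
  \<comment> \<open>The constant 4 is absorbed by two further factors \<open>n >= 2\<close>.\<close>
  have "a + b + 1 \<le> 2 * 2 * n ^ k" using assms(2,3) p by linarith
  also have "\<dots> \<le> n * n * n ^ k" using assms(1) by (intro mult_le_mono) auto
  also have "\<dots> = n ^ (k + 2)" by (simp add: power_add power2_eq_square)
  finally have "(a + b + 1) ^ 2 \<le> (n ^ (k + 2)) ^ 2" by (rule power_mono) simp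
  also have "\<dots> = n ^ (2 * k + 4)" by (simp add: power_add power_mult_distrib flip: power_mult) (simp add: mult.commute)
  finally show ?thesis using prod_encode_less[of a b] by linarith
qed

lemma enc_token_less_pow:
  fixes n :: nat
  assumes "2 \<le> n" "a \<le> n" "b \<le> n" "c \<le> n ^ k"
  shows "enc_token (a, b, c) < n ^ (4 * k + 16)"
proof -
  have up: "n \<le> n ^ Suc j" for j using assms(1) by simp
  \<comment> \<open>The exponent is raised so that it also bounds \<open>b\<close> when
    \<open>k = 0\<close>.\<close>
  have "c \<le> n ^ Suc k" using assms(1,4) by (meson le_trans lessI less_imp_le_nat power_increasing numeral_le_one_iff one_le_numeral)
  moreover have "b \<le> n ^ Suc k" using assms(3) up[of k] by linarith
  ultimately have "prod_encode (b, c) < n ^ (2 * Suc k + 4)"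
    using prod_encode_less_pow[OF assms(1)] by blast
  moreover have "a \<le> n ^ (2 * Suc k + 4)" using assms(2) up[of "2 * k + 5"] by simp
  ultimately have "prod_encode (a, prod_encode (b, c)) < n ^ (2 * (2 * Suc k + 4) + 4)"
    using prod_encode_less_pow[OF assms(1)] less_imp_le by blast
  moreover have "2 * (2 * Suc k + 4) + 4 = 4 * k + 16" by simp
  ultimately show ?thesis unfolding enc_token_def by (simp only: prod.case)
qed

text \<open>An integer bound for \<open>card E / n\<close> depending on \<open>n\<close> only; being
  at least 1, it can serve as a modulus for slots.\<close>

definition load :: "real \<Rightarrow> real \<Rightarrow> nat \<Rightarrow> nat" where
  "load cE kE n = nat \<lceil>max 1 (cE * log 2 (real n) powr kE)\<rceil>"

lemma load_ge: "max 1 (cE * log 2 (real n) powr kE) \<le> real (load cE kE n)"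
  unfolding load_def by (rule real_nat_ceiling_ge)

lemma load_pos: "0 < load cE kE n"
  using load_ge[of cE n kE] by linarith

text \<open>Both \<open>cE\<close> and \<open>kE\<close> may be negative, whence the absolute value
  and the maximum; the summand 2 pays for the lower bound 1 and for rounding up.\<close>

lemma load_le:
  assumes "2 \<le> n"
  shows "real (load cE kE n) \<le> (\<bar>cE\<bar> + 2) * log 2 (real n) powr max kE 0"
proof -
  let ?l = "log 2 (real n)"
  have l: "1 \<le> ?l" using assms by (simp add: le_log_iff)
  have l1: "1 \<le> ?l powr max kE 0" using l by (simp add: ge_one_powr_ge_zero)
  have "cE * ?l powr kE \<le> \<bar>cE\<bar> * ?l powr max kE 0"
    using l by (intro mult_mono powr_mono) auto
  also have "\<dots> \<le> (\<bar>cE\<bar> + 1) * ?l powr max kE 0" by (simp add: distrib_right)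
  finally have "cE * ?l powr kE \<le> (\<bar>cE\<bar> + 1) * ?l powr max kE 0" .
  moreover have "1 * 1 \<le> (\<bar>cE\<bar> + 1) * ?l powr max kE 0" using l1 by (intro mult_mono) auto
  ultimately have "max 1 (cE * ?l powr kE) \<le> (\<bar>cE\<bar> + 1) * ?l powr max kE 0" by simp
  moreover have "real (load cE kE n) \<le> max 1 (cE * ?l powr kE) + 1"
    unfolding load_def by linarith
  ultimately have "real (load cE kE n) \<le> (\<bar>cE\<bar> + 1) * ?l powr max kE 0 + ?l powr max kE 0"
    using l1 by linarith
  then show ?thesis by (simp add: algebra_simps)
qed

lemma rounds_le:
  assumes "2 \<le> n"
  shows "real (t4 (load cE kE n) n + 3 * sq n)
    \<le> 44 * (\<bar>cE\<bar> + 2)\<^sup>2 * sqrt (real n) * log 2 (real n) powr (1 + 2 * max kE 0)"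
proof -
  let ?l = "log 2 (real n)" and ?Q = "load cE kE n" and ?s = "sq n" and ?L = "lg n" and ?K = "max kE 0"
  have l: "1 \<le> ?l" using assms by (simp add: le_log_iff)
  have r: "1 \<le> sqrt (real n)" using assms by simp
  \<comment> \<open>Rounding up costs a factor of at most 2 for a number that is at least 1. Applied
    to the square root and the logarithm, this turns 11 into 44.\<close>
  have s: "real ?s \<le> 2 * sqrt (real n)" unfolding sq_def using r by linarith
  have L: "real ?L \<le> 2 * ?l" unfolding lg_def using l by linarith
  have "1 \<le> ?L" using l by (simp add: lg_def Suc_le_eq)
  moreover have "1 \<le> ?s" using r by (simp add: sq_def Suc_le_eq)
  moreover have Q: "1 \<le> ?Q" using load_pos by (simp add: Suc_le_eq)
  \<comment> \<open>Each summand is at most a multiple of the product, with coefficients 3 + 1 + 1 +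
    1 + 2 + 3 = 11.\<close>
  moreover have "t4 Q n + 3 * ?s \<le> 11 * (?s * ?L * (Q * Q))" if "1 \<le> Q" "1 \<le> ?s" "1 \<le> ?L" for Q
  proof -
    define Z where "Z = ?s * ?L * (Q * Q)"
    have "?s * 1 * (1 * 1) \<le> Z" "?s * ?L * (1 * 1) \<le> Z" "1 * ?L * (1 * 1) \<le> Z"
      "?s * 1 * (Q * Q) \<le> Z" "?s * 1 * (Q * 1) \<le> Z"
      unfolding Z_def by (intro mult_le_mono order_refl that)+
    moreover have "Q * ?s * Q = ?s * 1 * (Q * Q)" by simp
    ultimately show ?thesis
      unfolding Z_def[symmetric] t4_def t3_def t2_def t1_def t0_def mult_1_right mult_1_left by linarith
  qed
  ultimately have "t4 ?Q n + 3 * ?s \<le> 11 * (?s * ?L * (?Q * ?Q))" by blast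
  then have "real (t4 ?Q n + 3 * ?s) \<le> real (11 * (?s * ?L * (?Q * ?Q)))" by (simp only: of_nat_le_iff)
  also have "\<dots> = 11 * (real ?s * real ?L * (real ?Q * real ?Q))" by simp
  also have "\<dots> \<le> 11 * ((2 * sqrt (real n)) * (2 * ?l) *
      (((\<bar>cE\<bar> + 2) * ?l powr ?K) * ((\<bar>cE\<bar> + 2) * ?l powr ?K)))"
    using s L load_le[OF assms, of cE kE] l by (intro mult_mono mult_left_mono) auto
  also have "\<dots> = 44 * (\<bar>cE\<bar> + 2)\<^sup>2 * sqrt (real n) * (?l * (?l powr ?K * ?l powr ?K))"
    by (simp add: power2_eq_square)
  also have "?l * (?l powr ?K * ?l powr ?K) = ?l powr (1 + 2 * ?K)"
  proof -
    have "x * (x powr a * x powr a) = x powr (1 + 2 * a)" if "1 \<le> x" for x a :: real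
      using that unfolding mult_2 powr_add by simp
    then show ?thesis using l by blast
  qed
  finally show ?thesis .
qed

theorem theorem1:
  fixes cE kE cW :: real
  shows "\<exists>(A :: (nat list, nat list) hybrid_alg) C cT kT.
     hybrid_wf A C \<and> 0 < cT \<and>
     (\<forall>n E w W S. n \<ge> 2 \<longrightarrow> weighted_graph n E w W \<longrightarrow> graph_connected n E \<longrightarrow>
        real W \<le> real n powr cW \<longrightarrow>
        real (card E) \<le> cE * real n * (log 2 (real n)) powr kE \<longrightarrow>
        hybrid_run A (real C * log 2 (real n)) n E w S \<longrightarrow>
        (\<exists>T. real T \<le> cT * sqrt (real n) * (log 2 (real n)) powr kT \<and>
             (\<forall>v\<in>{1..n}. out A n (S T v) = topology E w)))"
proof -
  \<comment> \<open>\<open>n ^ k\<close> bounds the weights, and \<open>C\<close> is then the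
    exponent from \<open>enc_token_less_pow\<close>; both depend on \<open>cW\<close> alone.\<close>
  define k where "k = nat \<lceil>cW\<rceil>"
  define C where "C = 4 * k + 16"
  define A where "A = topology_alg (load cE kE) C"
  define cT where "cT = 44 * (\<bar>cE\<bar> + 2)\<^sup>2"
  have "\<exists>T. real T \<le> cT * sqrt (real n) * (log 2 (real n)) powr (1 + 2 * max kE 0) \<and>
             (\<forall>v\<in>{1..n}. out A n (S T v) = topology E w)"
    if n: "2 \<le> n" and wg: "weighted_graph n E w W" and conn: "graph_connected n E"
      and W: "real W \<le> real n powr cW"
      and cardE: "real (card E) \<le> cE * real n * (log 2 (real n)) powr kE"
      and run: "hybrid_run A (real C * log 2 (real n)) n E w S" for n E w W S
  proof -
    have "real n powr cW \<le> real n powr real k"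
      using n by (intro powr_mono) (auto simp: k_def real_nat_ceiling_ge)
    also have "\<dots> = real (n ^ k)" using n by (simp add: powr_realpow)
    finally have "real W \<le> real (n ^ k)" using W by linarith
    then have Wk: "W \<le> n ^ k" by (simp only: of_nat_le_iff)
    have "cE * log 2 (real n) powr kE * real n \<le> real (load cE kE n) * real n"
      using load_ge[of cE n kE] by (intro mult_right_mono) auto
    then have "real (card E) \<le> real (load cE kE n * n)" using cardE by (simp add: mult_ac)
    then have Q: "card E \<le> load cE kE n * n" by (simp only: of_nat_le_iff)
    interpret topology_run n E w W "load cE kE" C S
    proof
      fix x assume "x \<in> topology E w"
      then obtain a b where x: "x = (a, b, w a b)" and ab: "(a, b) \<in> E"
        by (auto simp: topology_def)
      then have "a \<le> n" "b \<le> n" "w a b \<le> W" using wg by (auto simp: weighted_graph_def)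
      with Wk show "enc_token x < n ^ C"
        using enc_token_less_pow[OF n, of a b "w a b" k] by (simp add: x C_def)
    qed (use n wg conn Q load_pos run in \<open>auto simp: A_def C_def\<close>)
    show ?thesis
      using rounds_le[OF n, of cE kE] out_eq_topology
      by (intro exI[of _ "t4 (load cE kE n) n + 3 * sq n"]) (auto simp: cT_def A_def V_def)
  qed
  moreover have "hybrid_wf A C" unfolding A_def by (rule topology_alg_wf)
  moreover have "0 < cT" by (simp add: cT_def)
  ultimately show ?thesis by blast
qed

end
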